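(* Let $M$ be a full-rank matroid. Then $M$ contains neither $I_3$ nor $F_7$ as an induced restriction if and only if either $M\in\mathcal E_3$, or there is some $t\ge3$ such that $M$ arises from $\mathrm{AG}^{\circ}(t-1,2)$ by a sequence of doublings.
   Context: A simple binary matroid (here just "matroid") is a pair $M=(E,G)$, where $G$ is identified with $\mathbb F_2^n\setminus\{0\}$ for some $n\ge0$ and $E\subseteq G$; $\dim(M)=n$. A flat of $G$ is a set $V\setminus\{0\}$ with $V$ a subspace of $\mathbb F_2^n$, of dimension $\dim V$; a hyperplane is a flat of dimension $n-1$. $M$ is full-rank if no flat of dimension less than $n$ contains $E$. $M$ contains $N=(F',G')$ as an induced restriction if there is an injective linear map $\varphi:G'\to G$ (linear on the underlying vector spaces) with $\varphi(F')=E\cap\varphi(G')$; $M\cong N$ if such a $\varphi$ is bijective. $\mathcal E_3$ is the class of matroids $M=(E,G)$ with $|E\cap F|$ even for every flat $F$ of dimension at least $3$. $I_3$ is the $3$-dimensional matroid whose ground set is $3$ linearly independent vectors; $F_7=(G,G)$ with $G=\mathbb F_2^3\setminus\{0\}$. For $t\ge2$, $\mathrm{AG}^{\circ}(t-1,2)$ is the matroid $((G\setminus H)\cup\{x\},G)$ with $G=\mathbb F_2^t\setminus\{0\}$, $H$ a hyperplane of $G$ and $x\in H$. The doubling of an $n$-dimensional matroid $(E,\mathbb F_2^n\setminus\{0\})$ is the $(n+1)$-dimensional matroid $(\{0,1\}\times E,\mathbb F_2^{n+1}\setminus\{0\})$. "$M$ arises from $M_0$ by a sequence of doublings" means there are matroids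 $M_0,M_1,\dots,M_s$ with $M_s\cong M$ and each $M_{i+1}$ isomorphic to the doubling of $M_i$. *)

theory Defs
  imports Complex_Main "HOL-Library.Z2" "HOL-Library.Function_Algebras"
begin

(* Since dimensions vary (and are quantified over) inside the statement, all spaces F_2^n are
   realised inside the single F_2-vector space of functions nat => bit, as the subspace of
   functions vanishing from coordinate n on.  The vector space notions are those of HOL's
   locale vector_space. *)

type_synonym bvec = "nat \<Rightarrow> bit"

definition bscale :: "bit \<Rightarrow> bvec \<Rightarrow> bvec" where
  "bscale c v = (\<lambda>i. c * v i)"

global_interpretation F2: vector_space bscale
  by unfold_locales (auto simp: bscale_def fun_eq_iff algebra_simps)

definition F2n :: "nat \<Rightarrow> bvec set" where
  "F2n n = {v. \<forall>i\<ge>n. v i = 0}"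

definition geom :: "nat \<Rightarrow> bvec set" where
  "geom n = F2n n - {0}"

definition flat :: "nat \<Rightarrow> nat \<Rightarrow> bvec set \<Rightarrow> bool" where
  "flat n k F \<longleftrightarrow> (\<exists>V. F2.subspace V \<and> V \<subseteq> F2n n \<and> F2.dim V = k \<and> F = V - {0})"

definition hyperplane :: "nat \<Rightarrow> bvec set \<Rightarrow> bool" where
  "hyperplane n H \<longleftrightarrow> n \<ge> 1 \<and> flat n (n - 1) H"

(* The pair (E, G) is recorded as E together with the dimension n, where G = geom n. *)
record bin_matroid =
  ground :: "bvec set"
  mdim :: nat

definition matroid :: "bin_matroid \<Rightarrow> bool" where
  "matroid M \<longleftrightarrow> ground M \<subseteq> geom (mdim M)"

definition full_rank :: "bin_matroid \<Rightarrow> bool" where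
  "full_rank M \<longleftrightarrow> \<not> (\<exists>k F. k < mdim M \<and> flat (mdim M) k F \<and> ground M \<subseteq> F)"

definition linear_between :: "nat \<Rightarrow> nat \<Rightarrow> (bvec \<Rightarrow> bvec) \<Rightarrow> bool" where
  "linear_between m n \<phi> \<longleftrightarrow>
     (\<forall>x\<in>F2n m. \<phi> x \<in> F2n n) \<and>
     (\<forall>x\<in>F2n m. \<forall>y\<in>F2n m. \<phi> (x + y) = \<phi> x + \<phi> y) \<and>
     (\<forall>c. \<forall>x\<in>F2n m. \<phi> (bscale c x) = bscale c (\<phi> x))"

definition embeds_via :: "(bvec \<Rightarrow> bvec) \<Rightarrow> bin_matroid \<Rightarrow> bin_matroid \<Rightarrow> bool" where
  "embeds_via \<phi> N M \<longleftrightarrow>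
     linear_between (mdim N) (mdim M) \<phi> \<and> inj_on \<phi> (F2n (mdim N)) \<and>
     \<phi> ` ground N = ground M \<inter> \<phi> ` geom (mdim N)"

definition contains_induced :: "bin_matroid \<Rightarrow> bin_matroid \<Rightarrow> bool" where
  "contains_induced M N \<longleftrightarrow> (\<exists>\<phi>. embeds_via \<phi> N M)"

definition matroid_iso :: "bin_matroid \<Rightarrow> bin_matroid \<Rightarrow> bool" where
  "matroid_iso M N \<longleftrightarrow>
     (\<exists>\<phi>. embeds_via \<phi> N M \<and> bij_betw \<phi> (geom (mdim N)) (geom (mdim M)))"

definition E3 :: "bin_matroid set" where
  "E3 = {M. matroid M \<and>
     (\<forall>k F. k \<ge> 3 \<and> flat (mdim M) k F \<longrightarrow> even (card (ground M \<inter> F)))}"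

(* I_3 and AG^o(t-1,2) are determined only up to isomorphism (by the choice of the three
   vectors, and of H and x); the predicates hold of every such choice. *)
definition is_I3 :: "bin_matroid \<Rightarrow> bool" where
  "is_I3 N \<longleftrightarrow> matroid N \<and> mdim N = 3 \<and> card (ground N) = 3 \<and> F2.independent (ground N)"

definition F7 :: bin_matroid where
  "F7 = \<lparr>ground = geom 3, mdim = 3\<rparr>"

definition is_AG_circ :: "nat \<Rightarrow> bin_matroid \<Rightarrow> bool" where
  "is_AG_circ t M \<longleftrightarrow> t \<ge> 2 \<and>
     (\<exists>H x. hyperplane t H \<and> x \<in> H \<and> M = \<lparr>ground = (geom t - H) \<union> {x}, mdim = t\<rparr>)"

(* case_nat b v is the vector (b, v 0, v 1, ...), i.e. F_2^(n+1) is read as F_2 x F_2^n. *)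
definition doubling :: "bin_matroid \<Rightarrow> bin_matroid" where
  "doubling M = \<lparr>ground = {case_nat b v | b v. b \<in> {0, 1} \<and> v \<in> ground M}, mdim = mdim M + 1\<rparr>"

definition arises_by_doublings :: "bin_matroid \<Rightarrow> bin_matroid \<Rightarrow> bool" where
  "arises_by_doublings M\<^sub>0 M \<longleftrightarrow>
     (\<exists>(s::nat) Ms. (\<forall>i\<le>s. matroid (Ms i)) \<and> Ms 0 = M\<^sub>0 \<and> matroid_iso (Ms s) M \<and>
        (\<forall>i<s. matroid_iso (Ms (i + 1)) (doubling (Ms i))))"

end

(*
Work with E = ground M and its translates. Excluding I_3 and F_7 says that for a, b, c in E, among
a+b, a+c, b+c, a+b+c at least one, but not every one, lies in E.

If every plane spanned by three elements of E meets E evenly, then the third difference of the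
indicator function of E vanishes on triples from E. It then vanishes on triples from the span of E,
one argument at a time, so the indicator is a quadratic form and all flats of dimension at least 3
meet E evenly.

Otherwise some plane spanned by E meets E in 5 points, i.e. is an AG-circ(2,2). On a subspace V the
matroids obtained from AG-circ by doublings are those with E = (V - K) u (x + W), where K is a
hyperplane of V, W a subspace of K of codimension at least 2, and x in K - W. This shape survives
adjoining one more element y of E: among the two K-cosets making up y + V, one lies in E entirely,
and the other meets E in nothing (W stays) or in a coset of W (W gains a dimension).
*)

theory Submission
  imports Defs
begin

text \<open>A doubling pulls \<open>E\<close> back along a projection. After s doublings the point x
  of AG-circ has become a coset x + W of the kernel W, and t is the dimension of V/W. Describing the
  result by K, W and x inside one fixed space replaces sequences of matroids by a single property,
  which can be carried along an induction over the elements of \<open>E\<close>; coordinates are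
  chosen only once, when the doublings have to be exhibited.

  The obstacle in the even case is that a third difference is not additive in its arguments: the
  defect is a fourth difference, so evenness on triples from \<open>E\<close> does not extend to the
  span by linearity alone. In the other case nothing is known about \<open>E\<close> on the new
  coset y + V except that y is in \<open>E\<close>; its shape has to be recovered from forbidden
  planes that meet both V and y + V.

  Both arguments only see the span of \<open>E\<close>. Full rank enters solely to identify this
  span with the whole space.\<close>

section \<open>Arithmetic and subspaces over F_2\<close>

lemma bvec_add_self [simp]: "v + v = (0::bvec)" "v + (v + w) = (w::bvec)"
    "2 * v = (0::bvec)"
  by (auto simp: fun_eq_iff)

lemmas bvec_ac = add.assoc add.commute add.left_commute

lemma bscale_simps [simp]: "bscale 0 v = 0" "bscale 1 v = v"
  by (auto simp: bscale_def fun_eq_iff)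

lemma F2_subspace_iff: "F2.subspace A \<longleftrightarrow> 0 \<in> A \<and> (\<forall>u\<in>A. \<forall>v\<in>A. u + v \<in> A)"
proof -
  have "bscale c v \<in> A" if "0 \<in> A" "v \<in> A" for c v
    using that by (cases c) auto
  then show ?thesis by (auto simp: F2.subspace_def)
qed

lemma subspace_add_cancel:
  assumes "F2.subspace A" "u \<in> A"
  shows "u + v \<in> A \<longleftrightarrow> v \<in> A" "v + u \<in> A \<longleftrightarrow> v \<in> A"
  using assms unfolding F2_subspace_iff by (metis bvec_add_self(2) add.commute)+

section \<open>The condition on triples, and the shape of doubled AG-circ matroids\<close>

text \<open>Dependent triples are kept: if 0 is not in \<open>E\<close> they satisfy both clauses.
  For instance a = b makes a + b + c = c a member and a + b = 0 a nonmember. So the condition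
  transfers along additive maps with no case distinction on independence.\<close>

definition I3_F7_free :: "bvec set \<Rightarrow> bool" where
  "I3_F7_free E \<longleftrightarrow> (\<forall>a\<in>E. \<forall>b\<in>E. \<forall>c\<in>E.
     (a + b \<in> E \<or> a + c \<in> E \<or> b + c \<in> E \<or> a + b + c \<in> E) \<and>
     \<not> (a + b \<in> E \<and> a + c \<in> E \<and> b + c \<in> E \<and> a + b + c \<in> E))"

definition adjoin :: "bvec \<Rightarrow> bvec set \<Rightarrow> bvec set" where
  "adjoin a A = {v. v \<in> A \<or> a + v \<in> A}"

lemma subspace_adjoin:
  assumes "F2.subspace A" shows "F2.subspace (adjoin a A)"
proof -
  have "u + v \<in> adjoin a A" if u: "u \<in> adjoin a A" and v: "v \<in> adjoin a A" for u v
  proof -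
    have *: "p + q \<in> A" if "p \<in> A" "q \<in> A" for p q
      using assms that by (auto simp: F2_subspace_iff)
    show ?thesis
      using u v *[of u v] *[of "a + u" v] *[of u "a + v"] *[of "a + u" "a + v"]
      by (auto simp: adjoin_def bvec_ac)
  qed
  then show ?thesis using assms by (auto simp: F2_subspace_iff adjoin_def)
qed

lemma bvec_diff [simp]: "u - v = u + (v::bvec)"
  by (auto simp: fun_eq_iff)

lemma span_insert_adjoin: "F2.span (insert a S) = adjoin a (F2.span S)"
proof -
  have "(\<exists>k. x - bscale k a \<in> F2.span S) \<longleftrightarrow> x \<in> F2.span S \<or> a + x \<in> F2.span S" for x
  proof -
    have "(\<exists>k. x - bscale k a \<in> F2.span S) \<longleftrightarrow> x - bscale 0 a \<in> F2.span S \<or> x - bscale 1 a \<in> F2.span S"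
      by (metis bit.exhaust)
    then show ?thesis by (simp add: bvec_ac)
  qed
  then show ?thesis by (auto simp: F2.span_insert adjoin_def)
qed

text \<open>The witness \<open>d\<close> expresses that \<open>W\<close> has codimension at least 2 in \<open>K\<close>; for codimension 1 the
  set \<open>E\<close> would be even on all planes.\<close>

definition AG_type :: "bvec set \<Rightarrow> bvec set \<Rightarrow> bool" where
  "AG_type E V \<longleftrightarrow> (\<exists>K W x d z. F2.subspace V \<and> F2.subspace K \<and> F2.subspace W \<and> W \<subseteq> K \<and> K \<subseteq> V \<and>
     z \<in> V - K \<and> (\<forall>u\<in>V - K. \<forall>v\<in>V - K. u + v \<in> K) \<and>
     x \<in> K - W \<and> d \<in> K \<and> d \<notin> W \<and> d + x \<notin> W \<and>
     (\<forall>v\<in>V. v \<in> E \<longleftrightarrow> v \<notin> K \<or> v + x \<in> W))"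

section \<open>Enlarging an AG-circ structure by one element\<close>

text \<open>Everything is deduced from the rules \<open>C1\<close>, \<open>C2\<close>,
  \<open>C3\<close> for \<open>G\<close>, the indicator of \<open>E\<close> on y + V shifted back to
  V. The main point is that a gap in one coset of K forces many members in the other, so that gaps
  in both cosets are contradictory.\<close>

lemma AG_type_adjoin:
  assumes "AG_type E V" "I3_F7_free E" "y \<in> E" "y \<notin> V"
  shows "AG_type E (adjoin y V)"
proof -
  obtain K W x d z where V: "F2.subspace V" and K: "F2.subspace K" and W: "F2.subspace W"
    and WK: "W \<subseteq> K" and KV: "K \<subseteq> V" and z: "z \<in> V" "z \<notin> K"
    and cod: "\<And>u v. u \<in> V \<Longrightarrow> v \<in> V \<Longrightarrow> u \<notin> K \<Longrightarrow> v \<notin> K \<Longrightarrow> u + v \<in> K"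
    and x: "x \<in> K" "x \<notin> W" and d: "d \<in> K" "d \<notin> W" "d + x \<notin> W"
    and E: "\<And>v. v \<in> V \<Longrightarrow> v \<in> E \<longleftrightarrow> v \<notin> K \<or> v + x \<in> W"
    using assms(1) unfolding AG_type_def by (auto 0 4)
  define G where "G = (\<lambda>v. y + v \<in> E)"
  note Vadd = F2.subspace_add[OF V]
  note Kadd = F2.subspace_add[OF K]
  have gd: "(p + q \<in> E \<or> p + r \<in> E \<or> q + r \<in> E \<or> p + q + r \<in> E) \<and>
     \<not> (p + q \<in> E \<and> p + r \<in> E \<and> q + r \<in> E \<and> p + q + r \<in> E)"
     if "p \<in> E" "q \<in> E" "r \<in> E" for p q r using assms(2) that unfolding I3_F7_free_def by blast
  \<comment> \<open>For a, b, u in V: \<open>C1\<close> and \<open>C2\<close> exclude I_3 for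
    triples with one, respectively two, elements in y + V, and \<open>C3\<close> excludes
    F_7.\<close>
  have C1: "G (u + a) \<or> G (u + b) \<or> G (u + a + b)"
    if "a \<in> E" "b \<in> E" "a + b \<notin> E" "G u" for a b u
    using gd[of a b "y + u"] that unfolding G_def by (auto simp: bvec_ac)
  have C2: "G (u + a) \<or> G (u + a + b)"
    if "a \<in> E" "b \<notin> E" "a + b \<notin> E" "G u" "G (u + b)" for a b u
    using gd[of a "y + u" "y + u + b"] that unfolding G_def by (auto simp: bvec_ac)
  have C3: "\<not> G (u + a + b)"
    if "a \<in> E" "b \<in> E" "a + b \<in> E" "G u" "G (u + a)" "G (u + b)" for a b u
    using gd[of a b "y + u"] that unfolding G_def by (auto simp: bvec_ac)
  have xV: "x \<in> V" using x KV by auto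
  have xE: "x \<in> E" using E[OF xV] W by (auto simp: F2_subspace_iff)
  \<comment> \<open>The line through x and an e in \<open>D\<close> meets \<open>E\<close> in x
    only. \<open>D\<close> contains d, hence is nonempty.\<close>
  define D where "D = {d \<in> K. d \<notin> W \<and> d + x \<notin> W}"
  have D: "e \<in> K" "e \<in> V" "e \<notin> E" "e + x \<notin> E" "e \<notin> W" "e + x \<notin> W" if "e \<in> D" for e
    using that KV E[of e] E[of "e + x"] x xV Kadd Vadd unfolding D_def by (auto simp: bvec_ac)
  have Dx: "e + x \<in> D" if "e \<in> D" for e
    using that x Kadd unfolding D_def by (auto simp: bvec_ac)
  have VmK: "v \<in> E" if "v \<in> V" "v \<notin> K" for v using E that by auto
  \<comment> \<open>Both u + v and u + v + e lie in V - K, hence in \<open>E\<close>, and their sum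
    e does not. By \<open>C1\<close>, a drop of \<open>G\<close> along e in one coset of K forces a
    member in every pair {v, v + e} of the other.\<close>
  have pair_hit: "G v \<or> G (v + e)"
    if "G u" "\<not> G (u + e)" "e \<in> D" "u \<in> V" "v \<in> V" "u + v \<notin> K" for u v e
  proof -
    have "u + v \<in> E" using that Vadd VmK by auto
    moreover have "u + v + e \<notin> K"
      using that D subspace_add_cancel[OF K, of e "u + v"] by auto
    then have "u + v + e \<in> E" using that Vadd VmK D by auto
    ultimately show ?thesis
      using C1[of "u + v" "u + v + e" u] that D by (auto simp: bvec_ac)
  qed
  \<comment> \<open>If \<open>G\<close> is not constant on a coset of K, it changes along a
    direction in \<open>D\<close>: when u + u' is not in \<open>D\<close>, it is the sum of d and u
    + u' + d, which are, and one of the two steps u, u + d, u' sees the change.\<close>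
  have change: "\<exists>u2 e. u2 \<in> V \<and> u2 + u \<in> K \<and> e \<in> D \<and> G u2 \<and> \<not> G (u2 + e)"
    if "u \<in> V" "G u" "u' \<in> V" "u + u' \<in> K" "\<not> G u'" for u u'
  proof (cases "u + u' \<in> D")
    case True
    then show ?thesis using that F2.subspace_0[OF K]
      by (intro exI[of _ u] exI[of _ "u + u'"]) (auto simp: bvec_ac)
  next
    case False
    have dD: "d \<in> D" using d by (auto simp: D_def)
    have "u + u' \<in> W \<or> u + u' + x \<in> W" using False that by (auto simp: D_def)
    then have e: "u + u' + d \<in> D"
    proof
      assume *: "u + u' \<in> W"
      then show ?thesis
        using dD that subspace_add_cancel(2)[OF W *, of d] subspace_add_cancel(2)[OF W *, of "d + x"]
          Kadd[of d "u + u'"]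
        by (auto simp: D_def bvec_ac)
    next
      assume *: "u + u' + x \<in> W"
      then show ?thesis
        using dD that subspace_add_cancel(2)[OF W *, of d] subspace_add_cancel(2)[OF W *, of "d + x"]
          Kadd[of d "u + u'"]
        by (auto simp: D_def bvec_ac)
    qed
    show ?thesis
    proof (cases "G (u + d)")
      case True
      then show ?thesis using that e d KV Vadd
        by (intro exI[of _ "u + d"] exI[of _ "u + u' + d"]) (auto simp: bvec_ac)
    next
      case False
      then show ?thesis using that dD F2.subspace_0[OF K]
        by (intro exI[of _ "u"] exI[of _ "d"]) (auto simp: bvec_ac)
    qed
  qed
  have xpair: "\<exists>v'\<in>V. v' + v \<in> K \<and> G v' \<and> G (v' + x)"
    if u: "u \<in> V" "G u" and u': "u' \<in> V" "u + u' \<in> K" "\<not> G u'" and v: "v \<in> V" "u + v \<notin> K" for u u' v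
  proof -
    obtain w e where w: "w \<in> V" "w + u \<in> K" "e \<in> D" "G w" "\<not> G (w + e)"
      using change[OF u u'] by blast
    have wv: "w + v' \<notin> K" if "v' + v \<in> K" for v'
    proof
      assume "w + v' \<in> K"
      from Kadd[OF Kadd[OF this that] w(2)] show False using v by (auto simp: bvec_ac)
    qed
    have h1: "G v' \<or> G (v' + e)" if "v' \<in> V" "v' + v \<in> K" for v'
      using pair_hit[OF w(4,5,3,1) that(1) wv[OF that(2)]] .
    \<comment> \<open>The coset of w also has a drop along e + x: at w itself, or else at w + x,
      where \<open>C2\<close> supplies the member.\<close>
    have "\<exists>w'\<in>V. w' + w \<in> K \<and> G w' \<and> \<not> G (w' + (e + x))"
    proof (cases "G (w + e + x)")
      case False then show ?thesis using w F2.subspace_0[OF K] by (intro bexI[of _ w]) (auto simp: bvec_ac)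
    next
      case True
      have "G (w + x)" using C2[of x "e + x" w] C2[of x "e" w] D[OF w(3)] xE w True by (auto simp: bvec_ac)
      then show ?thesis
        using w xV x Vadd by (intro bexI[of _ "w + x"]) (auto simp: bvec_ac)
    qed
    then obtain w' where w': "w' \<in> V" "w' + w \<in> K" "G w'" "\<not> G (w' + (e + x))" by auto
    have w'v: "w' + v' \<notin> K" if "v' + v \<in> K" for v'
    proof
      assume "w' + v' \<in> K"
      from Kadd[OF this w'(2)] wv[OF that] show False by (auto simp: bvec_ac)
    qed
    have h2: "G v' \<or> G (v' + (e + x))" if "v' \<in> V" "v' + v \<in> K" for v'
      using pair_hit[OF w'(3,4) Dx[OF w(3)] w'(1) that(1) w'v[OF that(2)]] .
    have K0: "0 \<in> K" using K by (rule F2.subspace_0)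
    have eK: "e \<in> K" "e \<in> V" using D[OF w(3)] by auto
    have m: "v + x \<in> V" "v + x + v \<in> K" "v + e \<in> V" "v + e + v \<in> K"
        "v + e + x \<in> V" "v + e + x + v \<in> K" "v + v \<in> K"
      using v xV x eK Vadd Kadd K0 by (auto simp: bvec_ac)
    \<comment> \<open>These are the edges of a 4-cycle with sides {v, v + x} and {v + e, v + e + x};
      a vertex cover of it contains one of the sides.\<close>
    have a: "G v \<or> G (v + e)" "G v \<or> G (v + e + x)" "G (v + x) \<or> G (v + e + x)" "G (v + x) \<or> G (v + e)"
      using h1[of v] h2[of v] h1[of "v + x"] h2[of "v + x"] v m by (auto simp: bvec_ac)
    have "(G v \<and> G (v + x)) \<or> (G (v + e) \<and> G (v + e + x))"
      using a by auto
    then show ?thesis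
    proof
      assume "G v \<and> G (v + x)"
      then show ?thesis using v m by (intro bexI[of _ v]) auto
    next
      assume "G (v + e) \<and> G (v + e + x)"
      then show ?thesis using v m by (intro bexI[of _ "v + e"]) (auto simp: bvec_ac)
    qed
  qed
  \<comment> \<open>If neither \<open>K\<close>-coset were full, \<open>G\<close> would hold on pairs \<open>{u, u + x}\<close> and
    \<open>{v, v + x}\<close>, one in each coset; with \<open>x\<close>, \<open>u + v\<close> and \<open>u + v + x\<close> this gives an \<open>F\<^sub>7\<close>.\<close>
  have "\<exists>p\<in>V. \<forall>v\<in>V. v + p \<in> K \<longrightarrow> G v"
  proof (rule ccontr)
    assume "\<not> ?thesis"
    then have nf: "\<exists>v\<in>V. v + p \<in> K \<and> \<not> G v" if "p \<in> V" for p using that by auto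
    have 0: "0 \<in> V" "G 0" using F2.subspace_0[OF V] assms(3) by (auto simp: G_def)
    obtain v0 where "v0 \<in> V" "0 + v0 \<in> K" "\<not> G v0" using nf[OF 0(1)] by auto
    from xpair[OF 0 this, of z] z obtain v where v: "v \<in> V" "v + z \<in> K" "G v" "G (v + x)" by auto
    have vK: "v \<notin> K" using v z subspace_add_cancel[OF K, of v z] by auto
    obtain v1 where "v1 \<in> V" "v + v1 \<in> K" "\<not> G v1" using nf[OF v(1)] by (auto simp: bvec_ac)
    from xpair[OF v(1,3) this, of 0] 0 vK
    obtain u where u: "u \<in> V" "u \<in> K" "G u" "G (u + x)" by auto
    have "u + v \<notin> K" "u + v + x \<notin> K" using vK u x
      by (auto simp: subspace_add_cancel[OF K])
    then have "u + v \<in> E" "u + v + x \<in> E" using VmK Vadd u v xV by auto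
    then show False using C3[of "u + v" "u + v + x" u] u v xE by (auto simp: bvec_ac)
  qed
  then obtain p where p: "p \<in> V" "\<And>v. v \<in> V \<Longrightarrow> v + p \<in> K \<Longrightarrow> G v" by auto
  have other: "G v \<longleftrightarrow> v + q \<in> W" if q: "q \<in> V" "q + p \<notin> K" "G q" and v: "v \<in> V" "v + p \<notin> K" for q v
  proof -
    \<comment> \<open>Members r and r + x + w of the other coset would complete an F_7 with p and p
      + x + w from the full coset: the differences r + p, r + p + x + w and x + w all lie in
      \<open>E\<close>.\<close>
    have nx: "\<not> G (r + (x + w))" if "r \<in> V" "r + p \<notin> K" "w \<in> W" "G r" for r w
    proof -
      have w: "w \<in> K" "w \<in> V" using that WK KV by auto
      have "r + p \<in> E" using VmK Vadd that p by auto
      moreover have "r + p + (x + w) \<in> E"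
        using VmK[of "r + p + (x + w)"] Vadd that p xV w Kadd[OF x(1) w(1)] subspace_add_cancel[OF K, of "x+w" "r + p"] by auto
      moreover have "x + w \<in> E" using E[of "x + w"] that w xV Vadd by (auto simp: bvec_ac)
      moreover have "G p" "G (p + (x + w))"
        using p Kadd x w Vadd xV F2.subspace_0[OF K] by (auto simp: bvec_ac)
      ultimately show ?thesis using C3[of "r + p" "r + p + (x + w)" p] that by (auto simp: bvec_ac)
    qed
    have qv: "q + v \<in> K" using cod[of "q + p" "v + p"] q v p Vadd by (auto simp: bvec_ac)
    have qvV: "q + v \<in> V" using q v Vadd by auto
    show ?thesis
    proof (cases "v + q \<in> W")
      case True
      \<comment> \<open>The members x and x + (v + q) have the nonmember v + q as their sum; of the
        three outcomes of \<open>C1\<close> at q, \<open>nx\<close> leaves only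
        \<open>G v\<close>.\<close>
      have "x + (v + q) \<in> E" using E[of "x + (v + q)"] True Vadd[OF qvV xV] by (auto simp: bvec_ac)
      moreover have "v + q \<notin> E" using E[of "v + q"] subspace_add_cancel(1)[OF W True, of x] qv qvV x by (auto simp: bvec_ac)
      moreover have "\<not> G (q + (x + 0))" "\<not> G (q + (x + (v + q)))"
        using nx[OF q(1,2) _ q(3)] F2.subspace_0[OF W] True by blast+
      ultimately show ?thesis using C1[of x "x + (v + q)" q] xE q True by (auto simp: bvec_ac)
    next
      case False
      have "\<not> G v"
      proof
        assume Gv: "G v"
        consider "v + q + x \<in> W" | "v + q + x \<notin> W" by auto
        then show False
        proof cases
          case 1
          then show False using nx[OF q(1,2) 1 q(3)] Gv by (auto simp: bvec_ac)
        next
          case 2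
          then have "q + v \<in> D" using False qv by (auto simp: D_def bvec_ac)
          from C2[of x "q + v" q] D[OF this] xE q Gv
          have "G (q + (x + 0)) \<or> G (v + (x + 0))" by (auto simp: bvec_ac)
          then show False using nx[OF q(1,2) F2.subspace_0[OF W] q(3)] nx[OF v F2.subspace_0[OF W] Gv] by auto
        qed
      qed
      then show ?thesis using False by auto
    qed
  qed
  \<comment> \<open>p + z represents the coset of K in V other than p + K. Its translate by y joins
    the hyperplane, which leaves the full coset y + p + K outside, as required.\<close>
  define K' where "K' = adjoin (y + p + z) K"
  have yV: "y + v \<notin> V" if "v \<in> V" for v using assms(4) subspace_add_cancel(2)[OF V that] by auto
  have K'V: "v \<in> K' \<longleftrightarrow> v \<in> K" if "v \<in> V" for v
  proof -
    have "y + (p + z + v) \<notin> K" using yV[of "p + z + v"] p z that Vadd KV by auto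
    then show ?thesis by (auto simp: K'_def adjoin_def bvec_ac)
  qed
  have K'y: "y + v \<in> K' \<longleftrightarrow> v + p \<notin> K" if "v \<in> V" for v
  proof -
    have "y + v \<notin> K" using yV[OF that] KV by auto
    moreover have "p + z + v \<in> K \<longleftrightarrow> v + p \<notin> K"
      using cod[of z "v + p"] z that p Vadd subspace_add_cancel(2)[OF K, of "v + p" z] by (auto simp: bvec_ac)
    ultimately show ?thesis by (auto simp: K'_def adjoin_def bvec_ac)
  qed
  have V'cases: "v \<in> V \<or> (\<exists>u\<in>V. v = y + u)" if "v \<in> adjoin y V" for v
    using that by (auto simp: adjoin_def intro!: bexI[of _ "y + v"])
  have VV': "v \<in> V \<Longrightarrow> v \<in> adjoin y V" for v by (auto simp: adjoin_def)
  have K'V': "K' \<subseteq> adjoin y V"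
  proof
    fix v assume "v \<in> K'"
    then have "v \<in> V \<or> y + (p + (z + v)) \<in> V" using KV by (auto simp: K'_def adjoin_def bvec_ac)
    moreover have "y + v \<in> V" if "y + (p + (z + v)) \<in> V"
      using Vadd[OF Vadd[OF p(1) z(1)] that] by (auto simp: bvec_ac)
    ultimately show "v \<in> adjoin y V" by (auto simp: adjoin_def)
  qed
  have cod': "u + v \<in> K'" if "u \<in> adjoin y V - K'" "v \<in> adjoin y V - K'" for u v
  proof -
    have u: "u \<in> adjoin y V" "u \<notin> K'" and v: "v \<in> adjoin y V" "v \<notin> K'" using that by auto
    have mixed: "y + (r + s) \<in> K'" if "r \<in> V" "s \<in> V" "r \<notin> K" "y + s \<notin> K'" for r s
      using that K'y[of s] K'y[of "r + s"] Vadd subspace_add_cancel(2)[OF K, of "s + p" r] by (auto simp: bvec_ac)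
    from V'cases[OF u(1)] V'cases[OF v(1)] consider "u \<in> V" "v \<in> V"
      | s where "u \<in> V" "s \<in> V" "v = y + s" | r where "r \<in> V" "u = y + r" "v \<in> V"
      | r s where "r \<in> V" "u = y + r" "s \<in> V" "v = y + s" by blast
    then show ?thesis
    proof cases
      case 1 then show ?thesis using u v K'V cod Vadd by auto
    next
      case 2 then show ?thesis using mixed[of u s] u v K'V by (auto simp: bvec_ac)
    next
      case 3 then show ?thesis using mixed[of v r] u v K'V by (auto simp: bvec_ac)
    next
      case 4 then show ?thesis using K'y[of r] K'y[of s] u v Kadd[of "r + p" "s + p"] K'V[of "r + s"] Vadd
        by (auto simp: bvec_ac)
    qed
  qed
  show ?thesis
  proof (cases "\<exists>q\<in>V. q + p \<notin> K \<and> G q")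
    case False
    have "v \<in> E \<longleftrightarrow> v \<notin> K' \<or> v + x \<in> W" if "v \<in> adjoin y V" for v
      using V'cases[OF that]
    proof
      assume "v \<in> V" then show ?thesis using E K'V by auto
    next
      assume "\<exists>u\<in>V. v = y + u"
      then obtain u where u: "u \<in> V" "v = y + u" by auto
      have "v + x \<notin> W" using yV[of "u + x"] u xV Vadd WK KV by (auto simp: bvec_ac)
      then show ?thesis using K'y[OF u(1)] p(2)[OF u(1)] False u by (auto simp: G_def)
    qed
    moreover have "W \<subseteq> K'" "K \<subseteq> K'" using WK by (auto simp: K'_def adjoin_def)
    ultimately show ?thesis unfolding AG_type_def
      using subspace_adjoin[OF V] subspace_adjoin[OF K] W K'V' cod' z VV' K'V x d
      by (intro exI[of _ K'] exI[of _ W] exI[of _ x] exI[of _ d] exI[of _ z]) (auto simp: K'_def)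
  next
    case True
    then obtain q where q: "q \<in> V" "q + p \<notin> K" "G q" by auto
    \<comment> \<open>The new members y + q + W inside K' must belong to x + W', so y + q + x has to
      join W.\<close>
    define W' where "W' = adjoin (y + q + x) W"
    have W'V: "v \<in> W' \<longleftrightarrow> v \<in> W" if "v \<in> V" for v
    proof -
      have "y + (q + x + v) \<notin> W" using yV[of "q + x + v"] q xV that Vadd KV WK by auto
      then show ?thesis by (auto simp: W'_def adjoin_def bvec_ac)
    qed
    have W'y: "y + v + x \<in> W' \<longleftrightarrow> v + q \<in> W" if "v \<in> V" for v
    proof -
      have "y + (v + x) \<notin> W" using yV[of "v + x"] xV that Vadd KV WK by auto
      then show ?thesis by (auto simp: W'_def adjoin_def bvec_ac)
    qed
    have "v \<in> E \<longleftrightarrow> v \<notin> K' \<or> v + x \<in> W'" if "v \<in> adjoin y V" for v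
      using V'cases[OF that]
    proof
      assume "v \<in> V" then show ?thesis using E K'V W'V[of "v + x"] Vadd xV by auto
    next
      assume "\<exists>u\<in>V. v = y + u"
      then obtain u where u: "u \<in> V" "v = y + u" by auto
      show ?thesis using K'y[OF u(1)] W'y[OF u(1)] p(2)[OF u(1)] other[OF q u(1)] u by (auto simp: G_def)
    qed
    moreover have "W' \<subseteq> K'"
    proof
      fix v assume v: "v \<in> W'"
      show "v \<in> K'"
      proof (cases "v \<in> W")
        case True then show ?thesis using WK by (auto simp: K'_def adjoin_def)
      next
        case False
        then have w: "y + q + x + v \<in> W" using v by (auto simp: W'_def adjoin_def)
        have "q + x + (y + q + x + v) + p \<notin> K"
          using subspace_add_cancel(1)[OF K Kadd[OF x(1) subsetD[OF WK w]], of "q + p"] q by (auto simp: bvec_ac)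
        then show ?thesis using K'y[of "q + x + (y + q + x + v)"] Vadd[OF Vadd[OF q(1) xV] subsetD[OF KV subsetD[OF WK w]]] by (auto simp: bvec_ac)
      qed
    qed
    moreover have "K \<subseteq> K'" by (auto simp: K'_def adjoin_def)
    moreover have "F2.subspace W'" using W by (auto simp: W'_def intro: subspace_adjoin)
    ultimately show ?thesis unfolding AG_type_def
      using subspace_adjoin[OF V] subspace_adjoin[OF K] K'V' cod' z VV' K'V W'V x d xV KV Vadd
      by (intro exI[of _ K'] exI[of _ W'] exI[of _ x] exI[of _ d] exI[of _ z]) (auto simp: K'_def)
  qed
qed

section \<open>Even planes: from triples in E to triples in its span\<close>

text \<open>The third difference at 0 of the indicator of \<open>E\<close>, modulo 2, without the
  term of the origin, which vanishes if 0 is not in \<open>E\<close>. A sum is used instead of a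
  cardinality so that dependent triples count repeated points with multiplicity.\<close>

definition even_plane :: "bvec set \<Rightarrow> bvec \<Rightarrow> bvec \<Rightarrow> bvec \<Rightarrow> bool" where
  "even_plane E a b c \<longleftrightarrow> even (of_bool (a \<in> E) + of_bool (b \<in> E) + of_bool (c \<in> E) + of_bool (a + b \<in> E)
     + of_bool (a + c \<in> E) + of_bool (b + c \<in> E) + of_bool (a + b + c \<in> E) :: nat)"

lemma span_induct_F2 [consumes 1, case_names zero add]:
  assumes "v \<in> F2.span S" "P 0" "\<And>x y. x \<in> S \<Longrightarrow> y \<in> F2.span S \<Longrightarrow> P y \<Longrightarrow> P (x + y)"
  shows "P v"
proof -
  have "v \<in> F2.span S \<and> P v"
    using assms(1)
  proof (induction rule: F2.span_induct_alt)
    case base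
    show ?case using F2.span_zero assms(2) by (rule conjI)
  next
    case (step c x y)
    show ?case
    proof (cases c)
      case zero
      then show ?thesis using step by simp
    next
      case one
      then have "bscale c x + y = x + y" by simp
      with step assms(3)[of x y] F2.span_add[OF F2.span_base, of x S y] show ?thesis by metis
    qed
  qed
  then show ?thesis ..
qed

lemma even_of_bool_iff: "even (of_bool P :: nat) \<longleftrightarrow> \<not> P"
  by simp

text \<open>The fourth difference of the indicator of \<open>E\<close> at \<open>a, b, b', c\<close> has two expansions.\<close>

lemma even_plane_cocycle:
  assumes "even_plane E a b c" "even_plane E a b' c" "even_plane E a b b'" "even_plane E a b (b' + c)"
  shows "even_plane E a (b + b') c"
  using assms unfolding even_plane_def by (simp only: bvec_ac) presburger

lemma even_plane_zero:
  assumes "0 \<notin> E" shows "even_plane E 0 b c" "even_plane E a 0 c" "even_plane E a b 0"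
  using assms unfolding even_plane_def even_add even_of_bool_iff by (simp_all, argo+)

text \<open>In the third argument \<open>even_plane_cocycle\<close> is circular: it reduces (a, b, d
  + c) to (a, d, b + c). Assumption \<open>c\<close> ranges over all pairs from \<open>E\<close>, so
  it also applies to sums of a, b, d that happen to lie in \<open>E\<close>.\<close>

lemma even_plane_add_right:
  assumes E: "\<And>a b c. a \<in> E \<Longrightarrow> b \<in> E \<Longrightarrow> c \<in> E \<Longrightarrow> even_plane E a b c"
    and c: "\<And>a b. a \<in> E \<Longrightarrow> b \<in> E \<Longrightarrow> even_plane E a b c"
    and abd: "a \<in> E" "b \<in> E" "d \<in> E"
  shows "even_plane E a b (d + c)"
proof -
  \<comment> \<open>The fourth difference at \<open>a, b, d, c\<close> vanishes: expand it along a pair whose sum lies in \<open>E\<close>;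
    if there is none, then \<open>a + b + d \<in> E\<close>, and the planes through \<open>c\<close> cover it.\<close>
  have sums: "a + b \<in> E \<longrightarrow> even_plane E (a + b) d c" "a + d \<in> E \<longrightarrow> even_plane E (a + d) b c"
    "b + d \<in> E \<longrightarrow> even_plane E (b + d) a c"
    "a + b + d \<in> E \<longrightarrow> even_plane E (a + b + d) a c \<and> even_plane E (a + b + d) b c \<and> even_plane E (a + b + d) d c"
    using c abd by auto
  have "even_plane E a b d" "even_plane E a b c" "even_plane E a d c" "even_plane E b d c"
    using E c abd by auto
  with sums abd show ?thesis
    unfolding even_plane_def even_add even_of_bool_iff by (simp only: bvec_ac bvec_add_self) argo
qed

text \<open>The order in which the arguments are freed matters. Once the last one ranges over the
  span, \<open>even_plane_cocycle\<close> can split a member x of \<open>E\<close> off another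
  argument: apart from the induction hypothesis, its premises are planes through x whose last
  argument is arbitrary in the span.\<close>

lemma even_plane_span:
  assumes 0: "0 \<notin> E" and E: "\<And>a b c. a \<in> E \<Longrightarrow> b \<in> E \<Longrightarrow> c \<in> E \<Longrightarrow> even_plane E a b c"
    and abc: "a \<in> F2.span E" "b \<in> F2.span E" "c \<in> F2.span E"
  shows "even_plane E a b c"
proof -
  have comm: "even_plane E a b c \<longleftrightarrow> even_plane E b a c" for a b c
    unfolding even_plane_def even_add even_of_bool_iff by (simp only: bvec_ac) argo
  have 1: "\<forall>a\<in>E. \<forall>b\<in>E. even_plane E a b c" if "c \<in> F2.span E" for c
    using that
  proof (induction rule: span_induct_F2)
    case zero then show ?case using even_plane_zero[OF 0] by blast
  next
    case (add x y) then show ?case using even_plane_add_right[OF E, of y _ _ x] by blast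
  qed
  have 2: "\<forall>c\<in>F2.span E. even_plane E a b c" if "b \<in> F2.span E" "a \<in> E" for a b
    using that(1)
  proof (induction rule: span_induct_F2)
    case zero then show ?case using even_plane_zero[OF 0] by blast
  next
    case (add x y)
    then show ?case
      using even_plane_cocycle[of E a x _ y] 1 that F2.span_add by blast
  qed
  have "\<forall>c\<in>F2.span E. \<forall>b\<in>F2.span E. even_plane E a b c" 
    using abc(1)
  proof (induction rule: span_induct_F2)
    case zero then show ?case using even_plane_zero[OF 0] by blast
  next
    case (add x y)
    then show ?case
      using even_plane_cocycle[of E _ x _ y] 2 F2.span_add comm by meson
  qed
  then show ?thesis using abc by auto
qed

section \<open>From even planes to even flats of higher dimension\<close>

text \<open>The number of points of \<open>E\<close> in the translate v + S. Translates enter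
  because adjoining a vector to S adds one translate of S.\<close>

definition count :: "bvec set \<Rightarrow> bvec set \<Rightarrow> bvec \<Rightarrow> nat" where
  "count E S v = card {u \<in> S. u + v \<in> E}"

lemma count_adjoin:
  assumes "finite S" "F2.subspace S" "b \<notin> S"
  shows "count E (adjoin b S) v = count E S v + count E S (b + v)" "finite (adjoin b S)"
proof -
  have bS: "adjoin b S = S \<union> (+) b ` S" 
    by (auto simp: adjoin_def intro: image_eqI[of _ _ "b + _"])
  then show "finite (adjoin b S)" using assms by auto
  have "{u \<in> adjoin b S. u + v \<in> E} = {u \<in> S. u + v \<in> E} \<union> (+) b ` {u \<in> S. u + (b + v) \<in> E}"
    unfolding bS by (auto simp: bvec_ac)
  moreover have "{u \<in> S. u + v \<in> E} \<inter> (+) b ` {u \<in> S. u + (b + v) \<in> E} = {}"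
    using assms subspace_add_cancel(2)[OF assms(2), of _ b] by auto
  moreover have "inj_on ((+) b) X" for X by auto
  ultimately show "count E (adjoin b S) v = count E S v + count E S (b + v)"
    unfolding count_def using assms(1) by (simp add: card_Un_disjoint card_image)
qed

text \<open>Evenness is shown for all translates of the span at once: each further basis vector
  makes a translate the disjoint union of two translates of the smaller span. Only the base case of
  three vectors uses even planes.\<close>

lemma even_count_span:
  assumes 0: "0 \<notin> E" and V: "F2.subspace V" and T: "\<And>a b c. a \<in> V \<Longrightarrow> b \<in> V \<Longrightarrow> c \<in> V \<Longrightarrow> even_plane E a b c"
    and B: "finite B" "F2.independent B" "B \<subseteq> V" "card B \<ge> 3"
  shows "even (card (E \<inter> F2.span B))"
proof -
  obtain c B1 where c: "B = insert c B1" "c \<notin> B1" "card B1 \<ge> 2"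
    using B by (metis card_le_Suc_iff eval_nat_numeral(3))
  obtain b B2 where b: "B1 = insert b B2" "b \<notin> B2" "card B2 \<ge> 1"
    using c by (metis card_le_Suc_iff eval_nat_numeral(2) numeral_2_eq_2 One_nat_def)
  obtain a B3 where a: "B2 = insert a B3" "a \<notin> B3"
    using b by (metis card_le_Suc_iff One_nat_def)
  have fB3: "finite B3" using B a b c by auto
  have "(\<forall>v\<in>V. even (count E (F2.span (B' \<union> {a,b,c})) v)) \<and> finite (F2.span (B' \<union> {a,b,c}))"
    if "finite B'" "B' \<subseteq> B3" for B'
    using that
  proof (induction rule: finite_induct)
    case empty
    have i: "F2.independent {a,b,c}" by (rule F2.independent_mono[OF B(2)]) (use a b c in auto)
    have i2: "F2.independent {b,c}" by (rule F2.independent_mono[OF i]) auto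
    have i3: "F2.independent {c}" by (rule F2.independent_mono[OF i]) auto
    have ni: "a \<notin> F2.span {b,c}" "b \<notin> F2.span {c}" "c \<notin> F2.span {}"
      using i i2 i3 a b c by (auto simp: F2.independent_insert split: if_splits)
    have sp: "F2.span {a,b,c} = adjoin a (F2.span {b,c})" "F2.span {b,c} = adjoin b (F2.span {c})"
       "F2.span {c} = adjoin c (F2.span {})"
      by (rule span_insert_adjoin)+
    have f0: "finite (F2.span {})" by simp
    note 1 = count_adjoin[OF f0 F2.subspace_span ni(3), folded sp]
    note 2 = count_adjoin[OF 1(2) F2.subspace_span ni(2), folded sp]
    note 3 = count_adjoin[OF 2(2) F2.subspace_span ni(1), folded sp]
    have c0: "even (count E (F2.span {}) v) \<longleftrightarrow> v \<notin> E" for v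
      by (auto simp: count_def conj_commute Collect_conv_if)
    have "even (count E (F2.span {a,b,c}) v)" if v: "v \<in> V" for v
    proof -
      \<comment> \<open>The eight points split into v + span {a, b} and c + v + span {a, b}; the
        planes on a, b, v and on a, b, c + v compare the parity on each of them with that on span
        {a, b}.\<close>
      have "even_plane E a b c" "even_plane E a b v" "even_plane E a b (c + v)"
        using T v a b c B F2.subspace_add[OF V] by auto
      then show ?thesis unfolding 1(1) 2(1) 3(1) even_add c0 even_plane_def even_of_bool_iff
        by (simp only: bvec_ac) argo
    qed
    then show ?case using 3(2) by simp
  next
    case (insert d B')
    have "F2.independent (insert d (B' \<union> {a,b,c}))"
      by (rule F2.independent_mono[OF B(2)]) (use a b c insert in auto)
    moreover have "d \<notin> B' \<union> {a,b,c}" using a b c insert by auto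
    ultimately have nd: "d \<notin> F2.span (B' \<union> {a,b,c})" by (simp add: F2.independent_insert)
    have dV: "d \<in> V" using insert a b c B by auto
    have sp: "F2.span (insert d B' \<union> {a,b,c}) = adjoin d (F2.span (B' \<union> {a,b,c}))"
      by (simp only: Un_insert_left span_insert_adjoin)
    show ?case unfolding sp using count_adjoin[OF _ F2.subspace_span nd] insert dV F2.subspace_add[OF V] by simp
  qed
  from this[OF fB3] have "even (count E (F2.span (B3 \<union> {a,b,c})) 0)"
    using F2.subspace_0[OF V] by auto
  moreover have "B3 \<union> {a,b,c} = B" using a b c by auto
  ultimately show ?thesis by (simp add: count_def Int_def conj_commute)
qed

section \<open>An odd plane as seed, and its growth to the span of E\<close>

text \<open>The nonzero points of K form the line through the two missing points p and q. Its third
  point p + q plays the role of x, with W = {0}, d = p and z = a.\<close>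

lemma AG_type_plane:
  assumes "0 \<notin> E" "a \<in> E" "a + p \<in> E" "a + q \<in> E" "a + p + q \<in> E" "p + q \<in> E" "p \<notin> E" "q \<notin> E"
  shows "AG_type E (F2.span {a, p, q})"
proof -
  define K where "K = {0, p, q, p + q}"
  have K: "F2.span {p, q} = K"
    by (auto simp: span_insert_adjoin adjoin_def K_def) (metis bvec_add_self(2) add.right_neutral)+
  have V: "F2.span {a, p, q} = adjoin a K"
    using K span_insert_adjoin by auto
  have ne: "a \<noteq> 0" "p \<noteq> 0" "q \<noteq> 0" "p \<noteq> q" "p + q \<noteq> 0" "a \<noteq> p" "a \<noteq> q" "a \<noteq> p + q"
    using assms by (auto simp: bvec_ac)
  have sK: "F2.subspace K" unfolding K[symmetric] by simp
  have sV: "F2.subspace (adjoin a K)" using sK by (rule subspace_adjoin)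
  have aK: "a \<notin> K" using ne by (auto simp: K_def)
  have VK: "u + v \<in> K" if "u \<in> adjoin a K - K" "v \<in> adjoin a K - K" for u v
    using that F2.subspace_add[OF sK, of "a + u" "a + v"] by (auto simp: adjoin_def bvec_ac)
  have mem: "v \<in> E \<longleftrightarrow> v \<notin> K \<or> v + (p + q) \<in> {0}" if v: "v \<in> adjoin a K" for v
  proof (cases "v \<in> K")
    case True then show ?thesis using assms ne by (auto simp: K_def bvec_ac)
  next
    case False
    then have "a + v \<in> K" using v by (auto simp: adjoin_def)
    then obtain k where "v = a + k" "k \<in> K" by (metis bvec_add_self(2))
    then show ?thesis using assms False by (auto simp: K_def bvec_ac)
  qed
  show ?thesis unfolding AG_type_def V
  proof (intro exI conjI)
    show "F2.subspace (adjoin a K)" "F2.subspace K" by (fact sV, fact sK)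
    show "F2.subspace {0}" by (rule F2.subspace_single_0)
    show "{0} \<subseteq> K" "p + q \<in> K - {0}" "p \<in> K" "p \<notin> {0}" "p + (p + q) \<notin> {0}" using ne by (auto simp: K_def)
    show "K \<subseteq> adjoin a K" "a \<in> adjoin a K - K" using aK by (auto simp: adjoin_def K_def)
    show "\<forall>u\<in>adjoin a K - K. \<forall>v\<in>adjoin a K - K. u + v \<in> K" using VK by blast
    show "\<forall>v\<in>adjoin a K. (v \<in> E) = (v \<notin> K \<or> v + (p + q) \<in> {0})" using mem by blast
  qed
qed

text \<open>Oddness makes the number of members among the four sums even, and the exclusions rule
  out 0 and 4, so exactly two sums are missing. The six instances of \<open>*\<close> are the six
  choices of the missing pair p, q, with a base point off the line through them.\<close>

lemma I3_F7_free_odd_plane: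
  assumes E: "0 \<notin> E" "I3_F7_free E" and abc: "a \<in> E" "b \<in> E" "c \<in> E" "\<not> even_plane E a b c"
  shows "\<exists>V. AG_type E V \<and> V \<subseteq> F2.span E"
proof -
  have *: ?thesis if "a \<in> E" "p + q \<in> E" "a + p \<in> E" "a + q \<in> E" "a + p + q \<in> E" "p \<notin> E" "q \<notin> E" for a p q
  proof -
    have "a \<in> F2.span E" "a + p \<in> F2.span E" "a + q \<in> F2.span E"
      using that by (auto intro: F2.span_base)
    then have "{a, p, q} \<subseteq> F2.span E"
      by (metis bvec_add_self(2) F2.span_add insert_subset empty_subsetI)
    then show ?thesis 
      using AG_type_plane[of E a p q] that E(1) F2.span_minimal[OF _ F2.subspace_span, of "{a, p, q}" E] by metis
  qed
  have "(a + b \<in> E \<or> a + c \<in> E \<or> b + c \<in> E \<or> a + b + c \<in> E) \<and>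
     \<not> (a + b \<in> E \<and> a + c \<in> E \<and> b + c \<in> E \<and> a + b + c \<in> E)" using E(2) abc unfolding I3_F7_free_def by blast
  then show ?thesis
    using abc *[of a "a + b" "a + c"] *[of b "a + b" "b + c"] *[of c "a + c" "b + c"]
      *[of a "a + b" "a + b + c"] *[of a "a + c" "a + b + c"] *[of b "b + c" "a + b + c"]
    unfolding even_plane_def even_add even_of_bool_iff
    by (simp only: bvec_ac bvec_add_self add.left_neutral add.right_neutral) argo
qed

lemma AG_type_extend:
  assumes "AG_type E V" "V \<subseteq> F2.span E" "I3_F7_free E" "finite E"
  shows "AG_type E (F2.span E)"
proof -
  have "\<exists>V'. AG_type E V' \<and> F \<union> V \<subseteq> V' \<and> V' \<subseteq> F2.span E" if "finite F" "F \<subseteq> E" for F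
    using that
  proof (induction rule: finite_induct)
    case empty then show ?case using assms by auto
  next
    case (insert y F)
    then obtain V' where V': "AG_type E V'" "F \<union> V \<subseteq> V'" "V' \<subseteq> F2.span E" by auto
    show ?case
    proof (cases "y \<in> V'")
      case True then show ?thesis using V' by auto
    next
      case False
      have "y \<in> F2.span E" using insert F2.span_base by auto
      then have "adjoin y V' \<subseteq> F2.span E" using V'(3) 
        using subspace_add_cancel(1)[OF F2.subspace_span, of y E] by (auto simp: adjoin_def)
      moreover have "F2.subspace V'" using V'(1) by (auto simp: AG_type_def)
      then have "insert y F \<union> V \<subseteq> adjoin y V'" using V'(2) F2.subspace_0 by (auto simp: adjoin_def)
      ultimately show ?thesis using AG_type_adjoin[OF V'(1) assms(3) _ False] insert by auto
    qed
  qed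
  from this[OF assms(4)] obtain V' where V': "AG_type E V'" "E \<subseteq> V'" "V' \<subseteq> F2.span E" by auto
  moreover have "F2.subspace V'" using V'(1) by (auto simp: AG_type_def)
  ultimately have "V' = F2.span E" using F2.span_minimal by blast
  then show ?thesis using V' by auto
qed

section \<open>The standard basis of F_2^n\<close>

definition unit_bvec :: "nat \<Rightarrow> bvec" where
  "unit_bvec i = (\<lambda>j. if j = i then 1 else 0)"

lemma subspace_F2n: "F2.subspace (F2n n)"
  by (auto simp: F2_subspace_iff F2n_def)

lemma F2n_0: "F2n 0 = {0}"
  by (auto simp: F2n_def)

lemma F2n_Suc: "F2n (Suc n) = adjoin (unit_bvec n) (F2n n)"
proof -
  have "(\<forall>i\<ge>Suc n. v i = 0) \<longleftrightarrow> (\<forall>i\<ge>n. v i = 0) \<or> (\<forall>i\<ge>n. (unit_bvec n + v) i = 0)" for v :: bvec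
  proof (cases "v n")
    case zero
    then show ?thesis by (auto simp: unit_bvec_def Suc_le_eq) (metis le_neq_implies_less zero_neq_one)
  next
    case one
    then show ?thesis by (auto simp: unit_bvec_def Suc_le_eq) 
  qed
  then show ?thesis by (auto simp: F2n_def adjoin_def)
qed

lemma unit_bvec_notin: "unit_bvec n \<notin> F2n n"
  by (auto simp: unit_bvec_def F2n_def)

lemma finite_F2n: "finite (F2n n)"
  by (induction n) (auto simp: F2n_0 F2n_Suc intro!: count_adjoin(2) subspace_F2n unit_bvec_notin)

lemma span_unit_bvec: "F2.span (unit_bvec ` {..<n}) = F2n n"
  by (induction n) (simp_all add: F2n_0 F2n_Suc lessThan_Suc span_insert_adjoin)

lemma independent_unit_bvec: "F2.independent (unit_bvec ` {..<n})"
proof (induction n)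
  case (Suc n)
  have "unit_bvec n \<notin> F2.span (unit_bvec ` {..<n})" by (simp only: span_unit_bvec unit_bvec_notin not_False_eq_True)
  from F2.independent_insertI[OF this Suc] show ?case unfolding lessThan_Suc image_insert .
qed (auto simp: F2.independent_empty)

lemma inj_unit_bvec: "inj_on unit_bvec A"
  by (rule inj_onI) (metis unit_bvec_def zero_neq_one)

lemma dim_F2n: "F2.dim (F2n n) = n"
  using F2.dim_span_eq_card_independent[OF independent_unit_bvec, of n]
  by (simp only: span_unit_bvec card_image[OF inj_unit_bvec] card_lessThan)

lemma independent_card_le:
  assumes "F2.independent B" "B \<subseteq> F2n n"
  shows "finite B \<and> card B \<le> n"
  using F2.independent_span_bound[OF _ assms(1), of "unit_bvec ` {..<n}"] assms(2)
  by (simp add: span_unit_bvec card_image[OF inj_unit_bvec])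

lemma unit_bvec_simps [simp]: "unit_bvec i \<noteq> 0" "unit_bvec i = unit_bvec j \<longleftrightarrow> i = j"
  using unit_bvec_notin[of i] F2.subspace_0[OF subspace_F2n, of i] inj_unit_bvec[of UNIV]
  by (auto simp: inj_eq)

section \<open>Induced I_3 and F_7 in terms of triples\<close>

lemma geom_3: "geom 3 = {unit_bvec 0, unit_bvec 1, unit_bvec 2, unit_bvec 0 + unit_bvec 1,
   unit_bvec 0 + unit_bvec 2, unit_bvec 1 + unit_bvec 2, unit_bvec 0 + unit_bvec 1 + unit_bvec 2}" (is "_ = ?A")
proof -
  have F: "F2n 3 = adjoin (unit_bvec 2) (adjoin (unit_bvec 1) (adjoin (unit_bvec 0) {0}))"
    by (simp add: numeral_3_eq_3 numeral_2_eq_2 F2n_Suc F2n_0)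
  have *: "u + v = w \<longleftrightarrow> v = u + w" for u v w :: bvec by auto
  have "F2n 3 = insert 0 ?A"
    unfolding F by (simp add: adjoin_def *) (auto simp: bvec_ac)
  moreover have "0 \<notin> ?A" using unit_bvec_notin[of 2]
    by (auto simp: fun_eq_iff unit_bvec_def)
  ultimately show ?thesis by (auto simp: geom_def)
qed

lemma zero_notin_matroid: "matroid M \<Longrightarrow> 0 \<notin> ground M"
  by (auto simp: matroid_def geom_def)

text \<open>A dependent triple of members has one of its sums in \<open>E\<close>: a = b gives a + b
  + c = c, and c = a + b gives a + b itself.\<close>

lemma zero_notin_sums:
  fixes E :: "bvec set"
  assumes "0 \<notin> E" "a \<in> E" "b \<in> E" "c \<in> E" "a + b \<notin> E" "a + c \<notin> E" "b + c \<notin> E" "a + b + c \<notin> E"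
  shows "0 \<notin> {a, b, c, a + b, a + c, b + c, a + b + c}"
proof -
  have eq: "u = v" if "u + v = 0" for u v :: bvec
    using that bvec_add_self(2)[of u v] by simp
  have "a \<noteq> b" "a \<noteq> c" "b \<noteq> c" "a + b \<noteq> c" using assms by (auto simp: bvec_ac)
  then have "a + b \<noteq> 0" "a + c \<noteq> 0" "b + c \<noteq> 0" "a + b + c \<noteq> 0" using eq by blast+
  then show ?thesis using assms by auto
qed

text \<open>The linear map sending the three unit vectors to a, b, c takes the seven listed values
  on \<open>geom 3\<close>; since none of them is 0, its kernel is trivial.\<close>

lemma embeds_via_triple:
  assumes abc: "0 \<notin> {a, b, c, a + b, a + c, b + c, a + b + c}" "{a, b, c} \<subseteq> F2n n"
  obtains \<phi> where "linear_between 3 n \<phi>" "inj_on \<phi> (F2n 3)"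
    "\<phi> (unit_bvec 0) = a" "\<phi> (unit_bvec 1) = b" "\<phi> (unit_bvec 2) = c"
    "\<phi> ` geom 3 = {a, b, c, a + b, a + c, b + c, a + b + c}"
proof
  define \<phi> where "\<phi> v = bscale (v 0) a + bscale (v 1) b + bscale (v 2) c" for v :: bvec
  have add: "\<phi> (u + v) = \<phi> u + \<phi> v" for u v
    by (simp add: \<phi>_def F2.scale_left_distrib bvec_ac del: add_bit_eq_xor)
  show e: "\<phi> (unit_bvec 0) = a" "\<phi> (unit_bvec 1) = b" "\<phi> (unit_bvec 2) = c"
    by (simp_all add: \<phi>_def unit_bvec_def)
  have "bscale k a + bscale l b + bscale m c \<in> F2n n" for k l m
    using abc subspace_F2n by (simp add: F2.subspace_add F2.subspace_scale)
  moreover have "\<phi> 0 = 0" by (simp add: \<phi>_def)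
  then have "\<phi> (bscale c v) = bscale c (\<phi> v)" for c v by (cases c) simp_all
  ultimately show "linear_between 3 n \<phi>" using add by (auto simp: linear_between_def \<phi>_def)
  show im: "\<phi> ` geom 3 = {a, b, c, a + b, a + c, b + c, a + b + c}"
    by (simp only: geom_3 image_insert image_empty add e)
  show "inj_on \<phi> (F2n 3)"
  proof (rule inj_onI)
    fix u v assume uv: "u \<in> F2n 3" "v \<in> F2n 3" "\<phi> u = \<phi> v"
    then have "\<phi> (u + v) = 0" by (simp add: add)
    then have "u + v \<notin> geom 3" using im abc by (metis image_eqI)
    then have "u + v = 0" using F2.subspace_add[OF subspace_F2n uv(1,2)] by (auto simp: geom_def)
    then have "u + (u + v) = u" by simp
    then show "u = v" by simp
  qed
qed

lemma I3_F7_free_if_not_contained: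
  assumes M: "matroid M" and I3: "\<not> (\<exists>N. is_I3 N \<and> contains_induced M N)"
    and F7: "\<not> contains_induced M F7"
  shows "I3_F7_free (ground M)"
  unfolding I3_F7_free_def
proof (intro ballI conjI)
  fix a b c assume abc: "a \<in> ground M" "b \<in> ground M" "c \<in> ground M"
  have sub: "{a, b, c} \<subseteq> F2n (mdim M)" using abc M by (auto simp: matroid_def geom_def)
  show "a + b \<in> ground M \<or> a + c \<in> ground M \<or> b + c \<in> ground M \<or> a + b + c \<in> ground M"
  proof (rule ccontr)
    assume no: "\<not> ?thesis"
    have "0 \<notin> {a, b, c, a + b, a + c, b + c, a + b + c}"
      using zero_notin_sums[OF zero_notin_matroid[OF M] abc] no by blast
    then obtain \<phi> where \<phi>: "linear_between 3 (mdim M) \<phi>" "inj_on \<phi> (F2n 3)"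
    "\<phi> (unit_bvec 0) = a" "\<phi> (unit_bvec 1) = b" "\<phi> (unit_bvec 2) = c"
    "\<phi> ` geom 3 = {a, b, c, a + b, a + c, b + c, a + b + c}"
      using embeds_via_triple sub by metis
    define N where "N = \<lparr>ground = unit_bvec ` {..<3}, mdim = 3\<rparr>"
    have u3: "unit_bvec ` {..<3} = {unit_bvec 0, unit_bvec 1, unit_bvec 2}"
      by (auto simp: lessThan_Suc eval_nat_numeral)
    have "is_I3 N" using independent_unit_bvec[of 3] card_image[OF inj_unit_bvec, of "{..<3}"]
      by (auto simp: is_I3_def N_def matroid_def geom_3 u3)
    moreover have "contains_induced M N" using \<phi> no abc
      by (auto simp: contains_induced_def embeds_via_def N_def u3 intro!: exI[of _ \<phi>])
    ultimately show False using I3 by blast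
  qed
  show "\<not> (a + b \<in> ground M \<and> a + c \<in> ground M \<and> b + c \<in> ground M \<and> a + b + c \<in> ground M)"
  proof
    assume yes: "a + b \<in> ground M \<and> a + c \<in> ground M \<and> b + c \<in> ground M \<and> a + b + c \<in> ground M"
    then have "0 \<notin> {a, b, c, a + b, a + c, b + c, a + b + c}"
      using zero_notin_matroid[OF M] abc by (metis insertE singletonD)
    then obtain \<phi> where \<phi>: "linear_between 3 (mdim M) \<phi>" "inj_on \<phi> (F2n 3)"
      "\<phi> ` geom 3 = {a, b, c, a + b, a + c, b + c, a + b + c}"
      using embeds_via_triple sub by metis
    then have "contains_induced M F7" using yes abc
      by (auto simp: contains_induced_def embeds_via_def F7_def intro!: exI[of _ \<phi>])
    then show False using F7 by blast
  qed
qed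

text \<open>The defining equation of \<open>embeds_via\<close> only speaks of nonzero vectors; v = 0
  is covered because \<open>\<phi> 0 = 0\<close> and 0 is never a member.\<close>

lemma embeds_via_mem:
  assumes "embeds_via \<phi> N M" "matroid M" "matroid N" "v \<in> F2n (mdim N)"
  shows "v \<in> ground N \<longleftrightarrow> \<phi> v \<in> ground M"
proof
  assume "v \<in> ground N" then show "\<phi> v \<in> ground M" using assms(1) by (auto simp: embeds_via_def)
next
  assume v: "\<phi> v \<in> ground M"
  have "0 \<in> F2n (mdim N)" by (simp add: F2.subspace_0[OF subspace_F2n])
  then have "\<phi> (0 + 0) = \<phi> 0 + \<phi> 0" using assms(1) unfolding embeds_via_def linear_between_def by blast
  then have "\<phi> 0 = 0" by simp
  then have "v \<noteq> 0" using v zero_notin_matroid[OF assms(2)] by metis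
  then have "\<phi> v \<in> ground M \<inter> \<phi> ` geom (mdim N)" using v assms(4) by (auto simp: geom_def)
  then have "\<phi> v \<in> \<phi> ` ground N" using assms(1) by (simp add: embeds_via_def)
  moreover have "ground N \<subseteq> F2n (mdim N)" using assms(3) by (auto simp: matroid_def geom_def)
  ultimately show "v \<in> ground N" using assms(1,4) inj_on_image_mem_iff unfolding embeds_via_def by metis
qed

lemma embeds_via_add:
  assumes "embeds_via \<phi> N M" "u \<in> F2n (mdim N)" "v \<in> F2n (mdim N)"
  shows "\<phi> (u + v) = \<phi> u + \<phi> v" "u + v \<in> F2n (mdim N)"
  using assms F2.subspace_add[OF subspace_F2n] by (auto simp: embeds_via_def linear_between_def)

lemma I3_F7_free_embeds:
  assumes e: "embeds_via \<phi> N M" and M: "matroid M" "matroid N" "I3_F7_free (ground M)"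
  shows "I3_F7_free (ground N)"
  unfolding I3_F7_free_def
proof (intro ballI)
  fix a b c assume abc: "a \<in> ground N" "b \<in> ground N" "c \<in> ground N"
  then have F: "a \<in> F2n (mdim N)" "b \<in> F2n (mdim N)" "c \<in> F2n (mdim N)"
    using M(2) by (auto simp: matroid_def geom_def)
  have "\<phi> a \<in> ground M" "\<phi> b \<in> ground M" "\<phi> c \<in> ground M" using embeds_via_mem[OF e M(1,2)] abc F by auto
  then show "(a + b \<in> ground N \<or> a + c \<in> ground N \<or> b + c \<in> ground N \<or> a + b + c \<in> ground N) \<and>
     \<not> (a + b \<in> ground N \<and> a + c \<in> ground N \<and> b + c \<in> ground N \<and> a + b + c \<in> ground N)"
    using M(3) unfolding I3_F7_free_def by (simp add: embeds_via_mem[OF e M(1,2)] embeds_via_add[OF e] F)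
qed

text \<open>The map runs from \<open>N\<close> to \<open>M\<close>, so here the condition is pushed
  forward; surjectivity on the nonzero vectors provides the preimages of the triple.\<close>

lemma I3_F7_free_iso:
  assumes iso: "matroid_iso M N" and M: "matroid M" "matroid N" "I3_F7_free (ground N)"
  shows "I3_F7_free (ground M)"
proof -
  obtain \<phi> where e: "embeds_via \<phi> N M" and b: "bij_betw \<phi> (geom (mdim N)) (geom (mdim M))"
    using iso by (auto simp: matroid_iso_def)
  have pre: "\<exists>u\<in>ground N. v = \<phi> u" if "v \<in> ground M" for v
  proof -
    have "v \<in> ground M \<inter> \<phi> ` geom (mdim N)" using that M(1) b by (auto simp: matroid_def bij_betw_def)
    then show ?thesis using e by (auto simp: embeds_via_def)
  qed
  show ?thesis
    unfolding I3_F7_free_def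
  proof (intro ballI)
    fix a' b' c' assume "a' \<in> ground M" "b' \<in> ground M" "c' \<in> ground M"
    then obtain a b c where abc: "a \<in> ground N" "b \<in> ground N" "c \<in> ground N"
      and eq: "a' = \<phi> a" "b' = \<phi> b" "c' = \<phi> c" using pre by metis
    then have F: "a \<in> F2n (mdim N)" "b \<in> F2n (mdim N)" "c \<in> F2n (mdim N)"
      using M(2) by (auto simp: matroid_def geom_def)
    show "(a' + b' \<in> ground M \<or> a' + c' \<in> ground M \<or> b' + c' \<in> ground M \<or> a' + b' + c' \<in> ground M) \<and>
      \<not> (a' + b' \<in> ground M \<and> a' + c' \<in> ground M \<and> b' + c' \<in> ground M \<and> a' + b' + c' \<in> ground M)"
      using M(3) abc unfolding I3_F7_free_def eq
      by (simp add: embeds_via_mem[OF e M(1,2), symmetric] embeds_via_add(1)[OF e, symmetric] embeds_via_add(2)[OF e] F)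
  qed
qed

lemma not_contained_if_I3_F7_free:
  assumes M: "matroid M" "I3_F7_free (ground M)"
  shows "\<not> (\<exists>N. is_I3 N \<and> contains_induced M N)" "\<not> contains_induced M F7"
proof -
  show "\<not> (\<exists>N. is_I3 N \<and> contains_induced M N)"
  proof
    assume "\<exists>N. is_I3 N \<and> contains_induced M N"
    then obtain N \<phi> where N: "is_I3 N" and e: "embeds_via \<phi> N M" by (auto simp: contains_induced_def)
    then have "I3_F7_free (ground N)" using I3_F7_free_embeds M by (auto simp: is_I3_def)
    moreover obtain p q r where pqr: "ground N = {p, q, r}" "p \<noteq> q" "p \<noteq> r" "q \<noteq> r" 
      using N unfolding is_I3_def by (metis card_3_iff)
    moreover have "F2.independent {p, q, r}" "F2.independent {q, r}" using N pqr F2.independent_mono[of "{p,q,r}" "{q,r}"]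
      by (auto simp: is_I3_def)
    then have "p \<notin> F2.span {q, r}" "q \<notin> F2.span {r}" "r \<noteq> 0" using pqr
      by (auto simp: F2.independent_insert F2.dependent_zero split: if_splits)
    then have "q + r \<noteq> p" "p + r \<noteq> q" "p + q \<noteq> r" "p \<noteq> 0" "q \<noteq> 0" "r \<noteq> 0" "p + q + r \<notin> {p, q, r}"
      by (auto simp: span_insert_adjoin adjoin_def bvec_ac)
    ultimately show False unfolding I3_F7_free_def
      by (auto simp: bvec_ac)
  qed
  show "\<not> contains_induced M F7"
  proof
    assume "contains_induced M F7"
    then obtain \<phi> where "embeds_via \<phi> F7 M" by (auto simp: contains_induced_def)
    then have "I3_F7_free (geom 3)" using I3_F7_free_embeds[of \<phi> F7 M] M by (auto simp: F7_def matroid_def)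
    then show False unfolding I3_F7_free_def
      by (metis geom_3 insertI1 insertI2)
  qed
qed

section \<open>Bases, rank and the span of a full-rank matroid\<close>

lemma span_eq_F2n:
  assumes "F2.independent B" "B \<subseteq> F2n n" "card B = n"
  shows "F2.span B = F2n n"
proof
  show "F2.span B \<subseteq> F2n n" using assms(2) subspace_F2n by (rule F2.span_minimal)
  show "F2n n \<subseteq> F2.span B"
  proof
    fix v assume v: "v \<in> F2n n"
    show "v \<in> F2.span B"
    proof (rule ccontr)
      assume v': "v \<notin> F2.span B"
      then have "v \<notin> B" using F2.span_base by auto
      moreover have "finite B" using independent_card_le[OF assms(1,2)] by simp
      ultimately have "card (insert v B) = Suc n" using assms(3) by simp
      moreover have "card (insert v B) \<le> n"
        using independent_card_le[OF F2.independent_insertI[OF v' assms(1)]] v assms(2) by simp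
      ultimately show False by simp
    qed
  qed
qed

lemma subspace_basis:
  assumes "F2.subspace U"
  obtains B where "F2.independent B" "F2.span B = U" "card B = F2.dim U"
proof -
  obtain B where B: "B \<subseteq> U" "F2.independent B" "U \<subseteq> F2.span B" "card B = F2.dim U"
    by (rule F2.basis_exists)
  then have "F2.span B = U" using F2.span_minimal[OF B(1) assms] by blast
  then show thesis using B that by blast
qed

text \<open>The span without 0 is itself a flat containing the ground set, so full rank forbids its
  dimension to be below that of the space.\<close>

lemma full_rank_span:
  assumes M: "matroid M" and fr: "full_rank M"
  shows "F2.span (ground M) = F2n (mdim M)"
proof -
  let ?U = "F2.span (ground M)"
  have sub: "?U \<subseteq> F2n (mdim M)"
    by (rule F2.span_minimal[OF _ subspace_F2n]) (use M in \<open>auto simp: matroid_def geom_def\<close>)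
  obtain B where B: "F2.independent B" "F2.span B = ?U" "card B = F2.dim ?U"
    using subspace_basis[OF F2.subspace_span] by blast
  have BF: "B \<subseteq> F2n (mdim M)" using B(2) sub F2.span_superset by fast
  have "\<not> F2.dim ?U < mdim M"
  proof
    assume "F2.dim ?U < mdim M"
    moreover have "flat (mdim M) (F2.dim ?U) (?U - {0})" using sub unfolding flat_def by blast
    moreover have "ground M \<subseteq> ?U - {0}"
      using zero_notin_matroid[OF M] F2.span_superset by blast
    ultimately show False using fr unfolding full_rank_def by blast
  qed
  then have "card B = mdim M" using B(3) independent_card_le[OF B(1) BF] by simp
  from span_eq_F2n[OF B(1) BF this] B(2) show ?thesis by simp
qed

lemma card_span:
  assumes "finite B" "F2.independent B"
  shows "finite (F2.span B) \<and> card (F2.span B) = 2 ^ card B"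
  using assms
proof (induction rule: finite_induct)
  case (insert b B)
  then have B: "F2.independent B" "b \<notin> F2.span B" by (auto simp: F2.independent_insert)
  then show ?case
    using count_adjoin(1)[OF _ F2.subspace_span B(2), of UNIV 0]
      count_adjoin(2)[OF _ F2.subspace_span B(2)] insert
    by (simp add: span_insert_adjoin count_def)
qed simp

lemma span_triple:
  assumes "0 \<notin> {a, b, c, a + b, a + c, b + c, a + b + c :: bvec}"
  shows "F2.independent {a, b, c}" "card {a, b, c} = 3"
    "F2.span {a, b, c} - {0} = {a, b, c, a + b, a + c, b + c, a + b + c}"
    "card {a, b, c, a + b, a + c, b + c, a + b + c} = 7"
proof -
  have *: "u = v \<longleftrightarrow> u + v = 0" for u v :: bvec by (metis bvec_add_self add.right_neutral)
  have ne: "a \<noteq> 0" "b \<noteq> 0" "c \<noteq> 0" "a \<noteq> b" "a \<noteq> c" "b \<noteq> c" "a \<noteq> b + c" "b \<noteq> a + c" "c \<noteq> a + b"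
    using assms *[of a b] *[of a c] *[of b c] *[of a "b + c"] *[of b "a + c"] *[of c "a + b"]
    by (auto simp: bvec_ac)
  note ne' = ne ne[THEN not_sym]
  show card3: "card {a, b, c} = 3" using ne by simp
  have span: "F2.span {a, b, c} = {0, a, b, c, a + b, a + c, b + c, a + b + c}"
  proof -
    have **: "u + v = w \<longleftrightarrow> v = u + w" for u v w :: bvec by auto
    show ?thesis by (simp add: span_insert_adjoin adjoin_def **) (auto simp: bvec_ac)
  qed
  show span0: "F2.span {a, b, c} - {0} = {a, b, c, a + b, a + c, b + c, a + b + c}"
    unfolding span using assms by blast
  show indep: "F2.independent {a, b, c}"
  proof -
    have "c \<notin> F2.span {}" "b \<notin> F2.span {c}" "a \<notin> F2.span {b, c}"
      using assms by (simp_all add: span_insert_adjoin adjoin_def bvec_ac)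
    then show ?thesis by (intro F2.independent_insertI F2.independent_empty)
  qed
  have "card (F2.span {a, b, c}) = 2 ^ card {a, b, c}" using card_span[OF _ indep] by blast
  then have "card (F2.span {a, b, c} - {0}) = 7"
    unfolding card3 by (simp add: card_Diff_singleton[OF F2.span_zero])
  then show "card {a, b, c, a + b, a + c, b + c, a + b + c} = 7"
    unfolding span0 .
qed

section \<open>The class E_3\<close>

text \<open>A violating triple is independent, and its plane is a 3-dimensional flat with 3 or 7
  points of the ground set, both odd.\<close>

lemma I3_F7_free_E3:
  assumes "M \<in> E3" shows "I3_F7_free (ground M)"
  unfolding I3_F7_free_def
proof (intro ballI conjI)
  have M: "matroid M" and ev: "\<And>k F. k \<ge> 3 \<Longrightarrow> flat (mdim M) k F \<Longrightarrow> even (card (ground M \<inter> F))"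
    using assms by (auto simp: E3_def)
  fix a b c assume abc: "a \<in> ground M" "b \<in> ground M" "c \<in> ground M"
  let ?A = "{a, b, c, a + b, a + c, b + c, a + b + c}"
  have sub: "{a, b, c} \<subseteq> F2n (mdim M)" using abc M by (auto simp: matroid_def geom_def)
  have even: "even (card (ground M \<inter> ?A))" if "0 \<notin> ?A"
  proof (rule ev[of 3])
    have "F2.dim (F2.span {a, b, c}) = 3"
      using F2.dim_span_eq_card_independent span_triple(1,2)[OF that] by simp
    then show "flat (mdim M) 3 ?A"
      unfolding flat_def span_triple(3)[OF that, symmetric]
      using F2.span_minimal[OF sub subspace_F2n] by blast
  qed simp
  show "a + b \<in> ground M \<or> a + c \<in> ground M \<or> b + c \<in> ground M \<or> a + b + c \<in> ground M"
  proof (rule ccontr)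
    assume no: "\<not> ?thesis"
    have A: "0 \<notin> ?A" using zero_notin_sums[OF zero_notin_matroid[OF M] abc] no by blast
    have "ground M \<inter> ?A = {a, b, c}" using no abc by auto
    then show False using even[OF A] span_triple(2)[OF A] by simp
  qed
  show "\<not> (a + b \<in> ground M \<and> a + c \<in> ground M \<and> b + c \<in> ground M \<and> a + b + c \<in> ground M)"
  proof
    assume yes: "a + b \<in> ground M \<and> a + c \<in> ground M \<and> b + c \<in> ground M \<and> a + b + c \<in> ground M"
    then have A: "0 \<notin> ?A" using zero_notin_matroid[OF M] abc by (metis insertE singletonD)
    have "ground M \<inter> ?A = ?A" using yes abc by auto
    then show False using even[OF A] span_triple(4)[OF A] by simp
  qed
qed

lemma E3_if_even_planes:
  assumes M: "matroid M"
    and T: "\<And>a b c. a \<in> F2n (mdim M) \<Longrightarrow> b \<in> F2n (mdim M) \<Longrightarrow> c \<in> F2n (mdim M) \<Longrightarrow> even_plane (ground M) a b c"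
  shows "M \<in> E3"
proof -
  have "even (card (ground M \<inter> F))" if k: "k \<ge> 3" and F: "flat (mdim M) k F" for k F
  proof -
    obtain U where U: "F2.subspace U" "U \<subseteq> F2n (mdim M)" "F2.dim U = k" "F = U - {0}"
      using F by (auto simp: flat_def)
    obtain B where B: "F2.independent B" "F2.span B = U" "card B = F2.dim U"
      using subspace_basis[OF U(1)] by blast
    have BF: "B \<subseteq> F2n (mdim M)" using B(2) U(2) F2.span_superset by fast
    have "even (card (ground M \<inter> U))"
      using even_count_span[OF zero_notin_matroid[OF M] subspace_F2n T _ B(1) BF]
        independent_card_le[OF B(1) BF] B U k by simp
    moreover have "ground M \<inter> F = ground M \<inter> U" using U(4) zero_notin_matroid[OF M] by auto
    ultimately show ?thesis by simp
  qed
  then show ?thesis using M by (auto simp: E3_def)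
qed

section \<open>AG-circ and doublings satisfy the condition\<close>

lemma ground_doubling: "ground (doubling M) = {w. (\<lambda>i. w (Suc i)) \<in> ground M}"
proof -
  have "\<exists>b v. w = case_nat b v \<and> b \<in> {0, 1} \<and> v \<in> ground M" if "(\<lambda>i. w (Suc i)) \<in> ground M" for w :: bvec
  proof (intro exI conjI)
    show "w = case_nat (w 0) (\<lambda>i. w (Suc i))" by (auto simp: fun_eq_iff split: nat.split)
    show "w 0 \<in> {0, 1}" by (cases "w 0") auto
  qed fact
  then show ?thesis by (auto simp: doubling_def)
qed

lemma mdim_doubling [simp]: "mdim (doubling M) = Suc (mdim M)"
  by (simp add: doubling_def)

lemma matroid_doubling:
  assumes "matroid M" shows "matroid (doubling M)"
proof -
  have "w \<in> geom (Suc (mdim M))" if "(\<lambda>i. w (Suc i)) \<in> ground M" for w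
  proof -
    have "(\<lambda>i. w (Suc i)) \<in> geom (mdim M)" using that assms by (auto simp: matroid_def)
    then have "\<forall>i\<ge>mdim M. w (Suc i) = 0" "w \<noteq> 0" by (auto simp: geom_def F2n_def zero_fun_def)
    then show ?thesis by (auto simp: geom_def F2n_def Suc_le_eq gr0_conv_Suc elim!: less_natE)
  qed
  then show ?thesis by (auto simp: matroid_def ground_doubling)
qed

text \<open>Dropping the new coordinate is additive and decides membership. Different elements of a
  triple may become equal, which is harmless as the condition on \<open>M\<close> covers dependent
  triples.\<close>

lemma I3_F7_free_doubling:
  assumes M: "matroid M" "I3_F7_free (ground M)"
  shows "I3_F7_free (ground (doubling M))"
  unfolding I3_F7_free_def
proof (intro ballI)
  define E where "E = ground M"
  define tail where "tail w = (\<lambda>i. w (Suc i))" for w :: bvec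
  have tail: "tail (u + v) = tail u + tail v" for u v by (auto simp: tail_def fun_eq_iff)
  have mem: "w \<in> ground (doubling M) \<longleftrightarrow> tail w \<in> E" for w
    by (simp add: ground_doubling tail_def E_def)
  fix a b c assume "a \<in> ground (doubling M)" "b \<in> ground (doubling M)" "c \<in> ground (doubling M)"
  then show "(a + b \<in> ground (doubling M) \<or> a + c \<in> ground (doubling M) \<or> b + c \<in> ground (doubling M) \<or>
         a + b + c \<in> ground (doubling M)) \<and>
        \<not> (a + b \<in> ground (doubling M) \<and> a + c \<in> ground (doubling M) \<and> b + c \<in> ground (doubling M) \<and>
           a + b + c \<in> ground (doubling M))"
    using M(2) unfolding I3_F7_free_def mem tail E_def by blast
qed

lemma matroid_AG_circ:
  assumes "is_AG_circ t M" shows "matroid M"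
  using assms by (auto simp: is_AG_circ_def hyperplane_def flat_def matroid_def geom_def)

text \<open>Against I_3: three members not all in K have one of their sums outside K, hence a
  member, while members inside K all equal x. Against F_7: a plane meets K in at least a line, but x
  is the only member in K.\<close>

lemma I3_F7_free_AG_circ:
  assumes "is_AG_circ t M" shows "I3_F7_free (ground M)"
proof -
  obtain K x where K: "F2.subspace K" "K \<subseteq> F2n t" "F2.dim K = t - 1" and x: "x \<in> K" "x \<noteq> 0" and t: "t \<ge> 2"
and M: "ground M = (geom t - (K - {0})) \<union> {x}"
  proof -
    obtain H x where H: "flat t (t - 1) H" "x \<in> H" "M = \<lparr>ground = geom t - H \<union> {x}, mdim = t\<rparr>" "t \<ge> 2"
      using assms unfolding is_AG_circ_def hyperplane_def by blast
    then obtain K where "F2.subspace K" "K \<subseteq> F2n t" "F2.dim K = t - 1" "H = K - {0}"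
      unfolding flat_def by blast
    with H show thesis by (intro that[of K x]) auto
  qed
  have 0: "0 \<in> K" using K(1) by (rule F2.subspace_0)
  have mem: "v \<in> ground M \<longleftrightarrow> v \<notin> K \<or> v = x" if "v \<in> F2n t" for v
    using that 0 unfolding M geom_def by auto
  \<comment> \<open>Otherwise u and v would extend a basis of K to t + 1 independent
    vectors.\<close>
  have cod: "u + v \<in> K" if u: "u \<in> F2n t" "u \<notin> K" and v: "v \<in> F2n t" "v \<notin> K" for u v
  proof (rule ccontr)
    assume uv: "u + v \<notin> K"
    obtain B where B: "F2.independent B" "F2.span B = K" "card B = F2.dim K"
      using subspace_basis[OF K(1)] by blast
    have BF: "B \<subseteq> F2n t" using B(2) K(2) F2.span_superset by fast
    have u1: "u \<notin> F2.span B" using B u by simp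
    have v1: "v \<notin> F2.span (insert u B)" using B v uv by (simp add: span_insert_adjoin adjoin_def)
    have i: "F2.independent (insert v (insert u B))"
      by (intro F2.independent_insertI u1 v1 B(1))
    have "u \<notin> B" "v \<notin> insert u B" using u1 v1 F2.span_superset by blast+
    then have "card (insert v (insert u B)) = t + 1"
      using B(3) K(3) t independent_card_le[OF B(1) BF] by simp
    then show False using independent_card_le[OF i, of t] BF u v by simp
  qed
  have add: "u + v \<in> F2n t" "u + v \<in> K \<longleftrightarrow> (u \<in> K \<longleftrightarrow> v \<in> K)" if "u \<in> F2n t" "v \<in> F2n t" for u v
    using that cod F2.subspace_add[OF subspace_F2n] subspace_add_cancel[OF K(1)] by auto
  show ?thesis
    unfolding I3_F7_free_def
  proof (intro ballI)
    fix a b c assume abc: "a \<in> ground M" "b \<in> ground M" "c \<in> ground M"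
    have xF: "x \<in> F2n t" using x K by auto
    then have F: "a \<in> F2n t" "b \<in> F2n t" "c \<in> F2n t" using abc by (auto simp: M geom_def)
    have abF: "a + b \<in> F2n t" using add F by simp
    show "(a + b \<in> ground M \<or> a + c \<in> ground M \<or> b + c \<in> ground M \<or> a + b + c \<in> ground M) \<and>
      \<not> (a + b \<in> ground M \<and> a + c \<in> ground M \<and> b + c \<in> ground M \<and> a + b + c \<in> ground M)"
    proof
      show "a + b \<in> ground M \<or> a + c \<in> ground M \<or> b + c \<in> ground M \<or> a + b + c \<in> ground M"
      proof (cases "a \<in> K \<and> b \<in> K \<and> c \<in> K")
        case True
        then have "a = x" "b = x" "c = x" using abc mem F by auto
        then show ?thesis using abc by simp
      next
        case False
        then show ?thesis using F abF by (auto simp: mem add)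
      qed
      show "\<not> (a + b \<in> ground M \<and> a + c \<in> ground M \<and> b + c \<in> ground M \<and> a + b + c \<in> ground M)"
      proof
        assume *: "a + b \<in> ground M \<and> a + c \<in> ground M \<and> b + c \<in> ground M \<and> a + b + c \<in> ground M"
        have z: "0 \<notin> ground M" using 0 x by (auto simp: M geom_def)
        have two: "p \<notin> K \<or> q \<notin> K" if "p \<in> ground M" "q \<in> ground M" "p + q \<in> ground M" "p \<in> F2n t" "q \<in> F2n t" for p q
        proof (rule ccontr)
          assume "\<not> ?thesis"
          then have "p = x" "q = x" using that mem by auto
          then show False using that z by simp
        qed
        have out: "p + q = x" if "p + q \<in> ground M" "p \<in> F2n t" "q \<in> F2n t" "p \<notin> K" "q \<notin> K" for p q
          using that mem add by auto
        \<comment> \<open>At most one of a, b, c is in K. If none is, a + b and a + c both equal x,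
          so b + c = 0; if one is, it equals x and so does the sum of the other two, so a + b + c =
          0.\<close>
        consider "a \<notin> K" "b \<notin> K" "c \<notin> K" | "a \<in> K" "b \<notin> K" "c \<notin> K" | "a \<notin> K" "b \<in> K" "c \<notin> K"
          | "a \<notin> K" "b \<notin> K" "c \<in> K"
          using two[of a b] two[of a c] two[of b c] abc F * by blast
        then show False
        proof cases
          case 1
          then have "a + b = a + c" using out[of a b] out[of a c] F * by simp
          then have "b + c = 0" by simp
          then show False using * z by simp
        next
          case 2
          then have "a = x" "b + c = x" using out[of b c] F * abc mem by auto
          then have "a + b + c = 0" by (simp add: add.assoc)
          then show False using * z by simp
        next
          case 3
          then have "b = x" "a + c = x" using out[of a c] F * abc mem by auto
          then have "(a + c) + b = 0" by simp
          then have "a + b + c = 0" by (simp add: bvec_ac)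
          then show False using * z by simp
        next
          case 4
          then have "c = x" "a + b = x" using out[of a b] F * abc mem by auto
          then have "a + b + c = 0" by simp
          then show False using * z by simp
        qed
      qed
    qed
  qed
qed

lemma I3_F7_free_arises:
  assumes "is_AG_circ t M\<^sub>0" "arises_by_doublings M\<^sub>0 M" "matroid M"
  shows "I3_F7_free (ground M)"
proof -
  obtain s :: nat and Ms where Ms: "\<forall>i\<le>s. matroid (Ms i)" "Ms 0 = M\<^sub>0" "matroid_iso (Ms s) M"
    "\<forall>i<s. matroid_iso (Ms (i + 1)) (doubling (Ms i))"
    using assms(2) unfolding arises_by_doublings_def by blast
  have "I3_F7_free (ground (Ms i))" if "i \<le> s" for i
    using that
  proof (induction i)
    case 0 then show ?case using I3_F7_free_AG_circ[OF assms(1)] Ms(2) by simp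
  next
    case (Suc i)
    then show ?case
      using I3_F7_free_iso[of "Ms (Suc i)" "doubling (Ms i)"] I3_F7_free_doubling[of "Ms i"] matroid_doubling Ms(1,4) by simp
  qed
  then show ?thesis
    using Ms(1,3) I3_F7_free_embeds assms(3) unfolding matroid_iso_def by blast
qed

section \<open>Exhibiting the doublings in adapted coordinates\<close>

text \<open>The coordinate map of an ordered basis takes the flag of spans of initial segments to
  the standard flag. The last property lets W and K be straightened simultaneously.\<close>

lemma coordinates:
  assumes bs: "distinct bs" "F2.independent (set bs)" "set bs \<subseteq> F2n n" "length bs = n"
  obtains \<phi> where "linear_between n n \<phi>" "bij_betw \<phi> (F2n n) (F2n n)"
    "\<And>i. i < n \<Longrightarrow> \<phi> (bs ! i) = unit_bvec i"
    "\<And>k u. k \<le> n \<Longrightarrow> u \<in> F2n n \<Longrightarrow> \<phi> u \<in> F2n k \<longleftrightarrow> u \<in> F2.span (set (take k bs))"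
proof
  let ?R = "F2.representation (set bs)"
  define \<phi> where "\<phi> u = (\<lambda>i. if i < n then ?R u (bs ! i) else 0)" for u
  have span: "F2.span (set bs) = F2n n"
    using span_eq_F2n[OF bs(2,3)] distinct_card[OF bs(1)] bs(4) by simp
  have F: "\<phi> u \<in> F2n n" for u by (auto simp: \<phi>_def F2n_def)
  show lin: "linear_between n n \<phi>"
    unfolding linear_between_def
  proof (intro conjI ballI allI)
    fix x y c assume xy: "x \<in> F2n n"
    show "\<phi> x \<in> F2n n" by (rule F)
    have "\<phi> 0 = 0" by (auto simp: \<phi>_def F2.representation_zero)
    then show "\<phi> (bscale c x) = bscale c (\<phi> x)" by (cases c) simp_all
    assume "y \<in> F2n n"
    then show "\<phi> (x + y) = \<phi> x + \<phi> y"
      using xy by (auto simp: \<phi>_def F2.representation_add[OF bs(2)] span fun_eq_iff)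
  qed
  show "\<phi> (bs ! i) = unit_bvec i" if "i < n" for i
  proof
    fix j
    have "bs ! i \<in> set bs" using that bs(4) by simp
    then show "\<phi> (bs ! i) j = unit_bvec i j"
      using that bs(4) nth_eq_iff_index_eq[OF bs(1), of j i]
      by (simp add: \<phi>_def unit_bvec_def F2.representation_basis[OF bs(2)])
  qed
  show iff: "\<phi> u \<in> F2n k \<longleftrightarrow> u \<in> F2.span (set (take k bs))" if k: "k \<le> n" and u: "u \<in> F2n n" for k u
  proof
    assume *: "\<phi> u \<in> F2n k"
    have "b \<in> set (take k bs)" if "?R u b \<noteq> 0" for b
    proof -
      from F2.representation_ne_zero[OF that] obtain i where i: "i < n" "b = bs ! i"
        using bs(4) by (auto simp: in_set_conv_nth)
      then have "\<phi> u i \<noteq> 0" using that by (simp add: \<phi>_def)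
      then have "i < k" using * by (auto simp: F2n_def not_le)
      then show ?thesis using i bs(4) by (auto simp: in_set_conv_nth)
    qed
    then have "(\<Sum>b | ?R u b \<noteq> 0. bscale (?R u b) b) \<in> F2.span (set (take k bs))"
      by (intro F2.span_sum F2.span_scale F2.span_base) auto
    then show "u \<in> F2.span (set (take k bs))"
      using F2.sum_nonzero_representation_eq[OF bs(2), of u] u span by simp
  next
    assume *: "u \<in> F2.span (set (take k bs))"
    have "?R u (bs ! i) = 0" if "i \<ge> k" "i < n" for i
    proof (rule ccontr)
      assume "?R u (bs ! i) \<noteq> 0"
      then have "bs ! i \<in> set (take k bs)"
        using F2.representation_extend[OF bs(2) *] set_take_subset[of k bs] F2.representation_ne_zero by metis
      then show False using that bs(1,4) by (auto simp: in_set_conv_nth nth_eq_iff_index_eq)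
    qed
    then show "\<phi> u \<in> F2n k" by (auto simp: \<phi>_def F2n_def)
  qed
  have inj: "inj_on \<phi> (F2n n)"
  proof (rule inj_onI)
    fix u v assume uv: "u \<in> F2n n" "v \<in> F2n n" "\<phi> u = \<phi> v"
    then have "\<phi> (u + v) = 0" using lin by (simp add: linear_between_def)
    then have "u + v = 0"
      using iff[of 0 "u + v"] F2.subspace_add[OF subspace_F2n uv(1,2)] by (simp add: F2n_0)
    then have "u + (u + v) = u" by simp
    then show "u = v" by simp
  qed
  moreover have "\<phi> ` F2n n \<subseteq> F2n n" using F by auto
  ultimately show "bij_betw \<phi> (F2n n) (F2n n)"
    using endo_inj_surj[OF finite_F2n] by (simp add: bij_betw_def)
qed

text \<open>Each doubling puts its free coordinate in front, so membership depends on the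
  coordinates from s on.\<close>

lemma doubling_power:
  "ground ((doubling ^^ s) M) = {w. (\<lambda>i. w (i + s)) \<in> ground M}" "mdim ((doubling ^^ s) M) = mdim M + s"
  by (induction s) (simp_all add: ground_doubling)

lemma matroid_iso_refl:
  assumes "matroid M" shows "matroid_iso M M"
proof -
  have "ground M = ground M \<inter> geom (mdim M)" using assms by (auto simp: matroid_def)
  then show ?thesis
    unfolding matroid_iso_def embeds_via_def linear_between_def
    by (intro exI[of _ id]) auto
qed

text \<open>A basis ordered as W, x, the rest of K, z turns W into \<open>F2n s\<close>, x into unit
  vector s and K into \<open>F2n (n - 1)\<close>. Membership then ignores the first s coordinates,
  and the remaining ones carry an AG-circ of dimension t = n - s.\<close>

lemma arises_if_AG_type:
  assumes M: "matroid M" and AG: "AG_type (ground M) (F2n (mdim M))"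
  shows "\<exists>t\<ge>3. \<exists>M\<^sub>0. is_AG_circ t M\<^sub>0 \<and> arises_by_doublings M\<^sub>0 M"
proof -
  define n where "n = mdim M"
  obtain K W x d z where K: "F2.subspace K" and W: "F2.subspace W"
    and WK: "W \<subseteq> K" and KV: "K \<subseteq> F2n n" and z: "z \<in> F2n n" "z \<notin> K"
    and cod: "\<And>u v. u \<in> F2n n \<Longrightarrow> v \<in> F2n n \<Longrightarrow> u \<notin> K \<Longrightarrow> v \<notin> K \<Longrightarrow> u + v \<in> K"
    and x: "x \<in> K" "x \<notin> W" and d: "d \<in> K" "d \<notin> W" "d + x \<notin> W"
    and E: "\<And>v. v \<in> F2n n \<Longrightarrow> v \<in> ground M \<longleftrightarrow> v \<notin> K \<or> v + x \<in> W"
    using AG unfolding AG_type_def n_def[symmetric] by (auto 0 4)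
  obtain BW where BW: "F2.independent BW" "F2.span BW = W"
    using subspace_basis[OF W] by blast
  have "F2.independent (insert x BW)" using BW x by (intro F2.independent_insertI) auto
  moreover have "insert x BW \<subseteq> K" using BW(2) x WK F2.span_superset[of BW] by auto
  ultimately obtain BK where BK: "insert x BW \<subseteq> BK" "BK \<subseteq> K" "F2.independent BK" "K \<subseteq> F2.span BK"
    using F2.maximal_independent_subset_extend by metis
  have spK: "F2.span BK = K" using BK(4) F2.span_minimal[OF BK(2) K] by blast
  have iV: "F2.independent (insert z BK)" using BK z spK by (intro F2.independent_insertI) auto
  have BKF: "insert z BK \<subseteq> F2n n" using BK KV z by auto
  have "F2.span (insert z BK) = F2n n"
  proof
    show "F2.span (insert z BK) \<subseteq> F2n n" using BKF subspace_F2n by (rule F2.span_minimal)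
    show "F2n n \<subseteq> F2.span (insert z BK)"
      using cod[OF z(1) _ z(2)] by (auto simp: span_insert_adjoin spK adjoin_def)
  qed
  then have cV: "card (insert z BK) = n"
    using F2.dim_span_eq_card_independent[OF iV] by (simp add: dim_F2n)
  have "finite (insert z BK)" using independent_card_le[OF iV BKF] by simp
  then have fin: "finite BW" "finite (BK - insert x BW)" using BK(1) by (auto intro: finite_subset)
  obtain ws where ws: "set ws = BW" "distinct ws" using finite_distinct_list[OF fin(1)] by blast
  obtain ks where ks: "set ks = BK - insert x BW" "distinct ks" using finite_distinct_list[OF fin(2)] by blast
  have xBW: "x \<notin> BW" using x BW F2.span_superset by blast
  have zBK: "z \<notin> BK" using z BK by auto
  define bs where "bs = ws @ [x] @ ks @ [z]"
  define s where "s = length ws"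
  \<comment> \<open>Modulo W the space has the basis x, \<open>ks\<close>, z.\<close>
  define t where "t = length ks + 2"
  have bsd: "distinct bs" using ws ks xBW zBK BK(1) by (auto simp: bs_def)
  have bss: "set bs = insert z BK" using ws ks BK(1) by (auto simp: bs_def)
  have lbs: "length bs = n" using distinct_card[OF bsd] bss cV by simp
  have nts: "n = t + s" using lbs by (simp add: bs_def t_def s_def)
  \<comment> \<open>Otherwise K would be the union of W and x + W, which d excludes; this is what
    raises t from 2 to at least 3.\<close>
  have "ks \<noteq> []"
  proof
    assume "ks = []"
    then have "BK = insert x BW" using ks BK(1) by auto
    then have "d \<in> adjoin x W" using d(1) spK BW(2) by (simp add: span_insert_adjoin)
    then show False using d by (auto simp: adjoin_def bvec_ac)
  qed
  then have t3: "t \<ge> 3" by (cases ks) (auto simp: t_def)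
  obtain \<phi> where lin: "linear_between n n \<phi>" and bij: "bij_betw \<phi> (F2n n) (F2n n)"
    and unit: "\<And>i. i < n \<Longrightarrow> \<phi> (bs ! i) = unit_bvec i"
    and flag: "\<And>k u. k \<le> n \<Longrightarrow> u \<in> F2n n \<Longrightarrow> \<phi> u \<in> F2n k \<longleftrightarrow> u \<in> F2.span (set (take k bs))"
    using coordinates[OF bsd, of n] iV BKF lbs bss by metis
  have \<phi>x: "\<phi> x = unit_bvec s" using unit[of s] nts t3 by (simp add: bs_def s_def nth_append)
  have \<phi>W: "\<phi> u \<in> F2n s \<longleftrightarrow> u \<in> W" if "u \<in> F2n n" for u
    using flag[OF _ that, of s] nts ws BW by (simp add: bs_def s_def)
  have "set (take (n - 1) bs) = BK"
    using lbs ws ks BK(1) by (auto simp: bs_def)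
  then have \<phi>K: "\<phi> u \<in> F2n (n - 1) \<longleftrightarrow> u \<in> K" if "u \<in> F2n n" for u
    using flag[OF _ that, of "n - 1"] spK by simp
  define M0 where "M0 = \<lparr>ground = (geom t - (F2n (t - 1) - {0})) \<union> {unit_bvec 0}, mdim = t\<rparr>"
  have "F2n (t - 1) \<subseteq> F2n t" by (auto simp: F2n_def)
  then have "flat t (t - 1) (F2n (t - 1) - {0})"
    unfolding flat_def using subspace_F2n dim_F2n by blast
  moreover have "unit_bvec 0 \<in> F2n (t - 1) - {0}" 
  proof -
    have "unit_bvec 0 \<in> F2n (t - 1)" using t3 by (auto simp: F2n_def unit_bvec_def)
    then show ?thesis by simp
  qed
  ultimately have circ: "is_AG_circ t M0" using t3 unfolding is_AG_circ_def hyperplane_def M0_def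
    by (intro conjI exI[of _ "F2n (t - 1) - {0}"] exI[of _ "unit_bvec 0"]) simp_all
  define Ms where "Ms i = (doubling ^^ i) M0" for i
  have mat: "matroid (Ms i)" for i
    unfolding Ms_def by (induction i) (simp_all add: matroid_doubling matroid_AG_circ[OF circ])
  have mdim: "mdim (Ms s) = n" by (simp add: Ms_def doubling_power M0_def nts)
  have mem: "\<phi> u \<in> ground (Ms s) \<longleftrightarrow> u \<in> ground M" if u: "u \<in> F2n n" for u
  proof -
    define w where "w = \<phi> u"
    define w' where "w' = (\<lambda>i. w (i + s))"
    have w: "w \<in> F2n n" using u bij by (auto simp: w_def bij_betw_def)
    have ge: "(\<forall>i\<ge>k. w' i = 0) \<longleftrightarrow> (\<forall>i\<ge>k+s. w i = 0)" for k
      unfolding w'_def by (metis add_le_cancel_right le_add_diff_inverse2 le_add2 le_trans)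
    have t: "w' \<in> F2n t" using w ge[of t] nts by (simp add: F2n_def)
    have t1: "w' \<in> F2n (t - 1) \<longleftrightarrow> u \<in> K"
      using ge[of "t - 1"] nts t3 \<phi>K[OF u] by (simp add: F2n_def w_def)
    have xF: "x \<in> F2n n" using x KV by auto
    \<comment> \<open>Shifting by s sends unit vector s to \<open>unit_bvec 0\<close> and kills
      \<open>F2n s\<close>, so the point of the AG-circ pulls back to a coset of
      \<open>F2n s\<close>.\<close>
    have "w' = unit_bvec 0 \<longleftrightarrow> w + unit_bvec s \<in> F2n s"
    proof -
      have "w' = unit_bvec 0 \<longleftrightarrow> (\<forall>j. w' j = unit_bvec 0 j)" by (auto simp: fun_eq_iff)
      also have "\<dots> \<longleftrightarrow> (\<forall>i\<ge>s. w i = unit_bvec s i)"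
        unfolding w'_def unit_bvec_def by (metis add_0 add_cancel_left_left add.commute le_add_diff_inverse2 le_add2)
      also have "\<dots> \<longleftrightarrow> w + unit_bvec s \<in> F2n s"
        by (auto simp: F2n_def unit_bvec_def simp del: add_bit_eq_xor) 
      finally show ?thesis .
    qed
    also have "w + unit_bvec s = \<phi> (u + x)" using lin u xF \<phi>x by (simp add: linear_between_def w_def)
    also have "\<phi> (u + x) \<in> F2n s \<longleftrightarrow> u + x \<in> W" using \<phi>W F2.subspace_add[OF subspace_F2n u xF] by simp
    finally have x1: "w' = unit_bvec 0 \<longleftrightarrow> u + x \<in> W" .
    have "w' \<noteq> 0" if "u \<notin> K" using that t1 F2.subspace_0[OF subspace_F2n] by auto
    then have "w' \<in> ground M0 \<longleftrightarrow> u \<notin> K \<or> u + x \<in> W"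
      using t t1 x1 by (auto simp: M0_def geom_def)
    then show ?thesis using E[OF u] by (simp add: Ms_def doubling_power w'_def w_def)
  qed
  have inj: "inj_on \<phi> (F2n n)" using bij by (simp add: bij_betw_def)
  have 0: "0 \<in> F2n n" by (rule F2.subspace_0[OF subspace_F2n])
  have "\<phi> 0 = 0" 
  proof -
    have "\<phi> (0 + 0) = \<phi> 0 + \<phi> 0" using lin 0 unfolding linear_between_def by blast
    then show ?thesis by simp
  qed
  then have "bij_betw \<phi> (geom n) (geom n)"
    unfolding geom_def using bij_betw_DiffI[OF bij, of "{0}" "{0}"] 0 by (simp add: bij_betw_def)
  moreover have "embeds_via \<phi> M (Ms s)"
  proof -
    have sub: "ground M \<subseteq> geom n" "geom n \<subseteq> F2n n" using M by (auto simp: matroid_def n_def geom_def)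
    have "\<phi> ` ground M = ground (Ms s) \<inter> \<phi> ` geom n"
      using mem sub E zero_notin_matroid[OF M] by blast
    then show ?thesis using lin inj unfolding embeds_via_def mdim n_def[symmetric] by blast
  qed
  ultimately have "matroid_iso (Ms s) M" unfolding matroid_iso_def mdim n_def[symmetric] by blast
  moreover have "matroid_iso (Ms (i + 1)) (doubling (Ms i))" for i
    using matroid_iso_refl[OF mat[of "i + 1"]] by (simp add: Ms_def)
  moreover have "Ms 0 = M0" by (simp add: Ms_def)
  ultimately have "arises_by_doublings M0 M" unfolding arises_by_doublings_def
    by (intro exI[of _ s] exI[of _ Ms]) (simp add: mat)
  then show ?thesis using t3 circ by blast
qed

theorem theorem1p4:
  fixes M :: bin_matroid
  assumes "matroid M" and "full_rank M"
  shows "(\<not> (\<exists>N. is_I3 N \<and> contains_induced M N) \<and> \<not> contains_induced M F7)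
    \<longleftrightarrow> (M \<in> E3 \<or> (\<exists>t\<ge>3. \<exists>M\<^sub>0. is_AG_circ t M\<^sub>0 \<and> arises_by_doublings M\<^sub>0 M))"
proof
  assume "\<not> (\<exists>N. is_I3 N \<and> contains_induced M N) \<and> \<not> contains_induced M F7"
  then have I3_F7_free: "I3_F7_free (ground M)" using I3_F7_free_if_not_contained[OF assms(1)] by blast
  note 0 = zero_notin_matroid[OF assms(1)]
  note span = full_rank_span[OF assms]
  show "M \<in> E3 \<or> (\<exists>t\<ge>3. \<exists>M\<^sub>0. is_AG_circ t M\<^sub>0 \<and> arises_by_doublings M\<^sub>0 M)"
  proof (cases "\<forall>a\<in>ground M. \<forall>b\<in>ground M. \<forall>c\<in>ground M. even_plane (ground M) a b c")
    case True
    then show ?thesis using E3_if_even_planes[OF assms(1)] even_plane_span[OF 0] span by blast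
  next
    case False
    then obtain V where V: "AG_type (ground M) V" "V \<subseteq> F2.span (ground M)"
      using I3_F7_free_odd_plane[OF 0 I3_F7_free] by blast
    have "finite (ground M)"
      using assms(1) finite_F2n[of "mdim M"] by (auto simp: matroid_def geom_def intro: finite_subset)
    then show ?thesis using arises_if_AG_type[OF assms(1)] AG_type_extend[OF V I3_F7_free] span by simp
  qed
next
  assume "M \<in> E3 \<or> (\<exists>t\<ge>3. \<exists>M\<^sub>0. is_AG_circ t M\<^sub>0 \<and> arises_by_doublings M\<^sub>0 M)"
  then have "I3_F7_free (ground M)" using I3_F7_free_E3 I3_F7_free_arises assms(1) by blast
  then show "\<not> (\<exists>N. is_I3 N \<and> contains_induced M N) \<and> \<not> contains_induced M F7"
    using not_contained_if_I3_F7_free[OF assms(1)] by blast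
qed

end
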